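(* The Monophonic rank problem restricted to starlike graphs belongs to $\mathrm{P}$; that is, there is a polynomial-time algorithm that, given a starlike graph $G$ and an integer $k$, decides whether $r(G) \ge k$, where $r(G)$ denotes the monophonic rank of $G$.
   Context: Graphs are finite, simple and undirected. $N(v)$ and $N[v]$ denote the open and closed neighborhoods of a vertex $v$. A set $S \subseteq V(G)$ is monophonically convex if the vertices of every induced path of $G$ joining two vertices of $S$ are contained in $S$. The monophonic convex hull $\langle S \rangle$ of $S$ is the smallest monophonically convex set containing $S$. A set $S \subseteq V(G)$ is monophonic convexly independent if $v \notin \langle S - \{v\} \rangle$ for every $v \in S$. The monophonic rank $r(G)$ is the size of a largest monophonic convexly independent set of $G$. The Monophonic rank problem is: given a graph $G$ and an integer $k$, decide whether $r(G) \ge k$. A graph $G$ is starlike if $V(G)$ admits a partition into cliques $(V_0, V_1, \ldots, V_t)$ such that $V_0$ is a maximal clique and, for every $i \in \{1, \ldots, t\}$ and all $u, v \in V_i$, it holds $N[u] - V_i = N[v] - V_i \subset V_0$. *)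

theory Defs
  imports
    Main
    "HOL-Library.Disjoint_Sets"
    "HOL-Library.Log_Nat"
    "HOL-Computational_Algebra.Polynomial"
    "Graph_Theory.Graph_Theory"
begin

section \<open>Monophonic convexity\<close>

text \<open>
  Finite simple undirected graphs are the symmetric loop-free finite digraphs of the locale
  \<^locale>\<open>pair_graph\<close>; a path is given by its list of vertices.
\<close>

definition induced_path :: "'a pair_pre_digraph \<Rightarrow> 'a list \<Rightarrow> bool" where
  "induced_path G p \<longleftrightarrow> vpath p (with_proj G) \<and>
     (\<forall>i j. i < j \<and> j < length p \<and> (p ! i, p ! j) \<in> parcs G \<longrightarrow> j = Suc i)"

definition monophonic_convex :: "'a pair_pre_digraph \<Rightarrow> 'a set \<Rightarrow> bool" where
  "monophonic_convex G S \<longleftrightarrow> S \<subseteq> pverts G \<and>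
     (\<forall>p. induced_path G p \<and> hd p \<in> S \<and> last p \<in> S \<longrightarrow> set p \<subseteq> S)"

definition monophonic_hull :: "'a pair_pre_digraph \<Rightarrow> 'a set \<Rightarrow> 'a set" where
  "monophonic_hull G S = monophonic_convex G hull S"

definition convexly_independent :: "'a pair_pre_digraph \<Rightarrow> 'a set \<Rightarrow> bool" where
  "convexly_independent G S \<longleftrightarrow> S \<subseteq> pverts G \<and>
     (\<forall>v\<in>S. v \<notin> monophonic_hull G (S - {v}))"

definition monophonic_rank :: "'a pair_pre_digraph \<Rightarrow> nat" where
  "monophonic_rank G = Max {card S | S. convexly_independent G S}"


section \<open>Starlike graphs\<close>

definition closed_nbhd :: "'a pair_pre_digraph \<Rightarrow> 'a \<Rightarrow> 'a set" where
  "closed_nbhd G v = insert v {u. (v, u) \<in> parcs G}"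

definition clique :: "'a pair_pre_digraph \<Rightarrow> 'a set \<Rightarrow> bool" where
  "clique G C \<longleftrightarrow> C \<subseteq> pverts G \<and> (\<forall>u\<in>C. \<forall>v\<in>C. u \<noteq> v \<longrightarrow> (u, v) \<in> parcs G)"

definition maximal_clique :: "'a pair_pre_digraph \<Rightarrow> 'a set \<Rightarrow> bool" where
  "maximal_clique G C \<longleftrightarrow> clique G C \<and> \<not> (\<exists>D. clique G D \<and> C \<subset> D)"

text \<open>
  The parts \<open>V\<^sub>1, \<dots>, V\<^sub>t\<close> are the members of the partition other than \<open>V\<^sub>0\<close>; their order is
  irrelevant, and \<open>t = 0\<close> (a complete graph) is allowed.
\<close>

definition starlike :: "'a pair_pre_digraph \<Rightarrow> bool" where
  "starlike G \<longleftrightarrow> (\<exists>\<V> V\<^sub>0. partition_on (pverts G) \<V> \<and> (\<forall>C\<in>\<V>. clique G C) \<and>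
     V\<^sub>0 \<in> \<V> \<and> maximal_clique G V\<^sub>0 \<and>
     (\<forall>W \<in> \<V> - {V\<^sub>0}. \<forall>u\<in>W. \<forall>v\<in>W.
        closed_nbhd G u - W = closed_nbhd G v - W \<and> closed_nbhd G v - W \<subset> V\<^sub>0))"


section \<open>Polynomial time\<close>

text \<open>
  The machine model is the random access machine of Cook and Reckhow (Time bounded random access
  machines, 1973), with a fixed finite program, integer registers \<open>X\<^sub>0, X\<^sub>1, \<dots>\<close> that are all
  initially 0, and a read-once input tape of integers. Every instruction has unit cost. As there
  is no multiplication, \<open>t\<close> steps increase the bit lengths of the registers by at most
  \<open>t + O(1)\<close>, so that polynomial time on this machine coincides with polynomial time on
  Turing machines.
\<close>

datatype instr =
    Const nat int       \<comment> \<open>\<open>X\<^sub>i := c\<close>\<close>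
  | Add nat nat nat     \<comment> \<open>\<open>X\<^sub>i := X\<^sub>j + X\<^sub>k\<close>\<close>
  | Sub nat nat nat     \<comment> \<open>\<open>X\<^sub>i := X\<^sub>j - X\<^sub>k\<close>\<close>
  | Load nat nat        \<comment> \<open>\<open>X\<^sub>i :=\<close> the register whose address is in \<open>X\<^sub>j\<close>\<close>
  | Store nat nat       \<comment> \<open>the register whose address is in \<open>X\<^sub>i\<close> \<open>:= X\<^sub>j\<close>\<close>
  | Read nat            \<comment> \<open>\<open>X\<^sub>i :=\<close> next input integer\<close>
  | JumpPos nat nat     \<comment> \<open>go to instruction \<open>l\<close> if \<open>X\<^sub>j > 0\<close>\<close>
  | Halt bool           \<comment> \<open>halt and accept (\<open>True\<close>) or reject (\<open>False\<close>)\<close>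

text \<open>
  A configuration consists of the program counter, the registers and the unread input.
  Negative addresses are read as 0, and so is the input beyond its end. A halted machine, and one
  whose program counter has left the program, stays in its configuration; the latter gives no
  answer.
\<close>

type_synonym config = "nat \<times> (nat \<Rightarrow> int) \<times> int list"

fun exec :: "instr \<Rightarrow> config \<Rightarrow> config" where
  "exec (Const i c) (pc, X, xs) = (Suc pc, X(i := c), xs)"
| "exec (Add i j k) (pc, X, xs) = (Suc pc, X(i := X j + X k), xs)"
| "exec (Sub i j k) (pc, X, xs) = (Suc pc, X(i := X j - X k), xs)"
| "exec (Load i j) (pc, X, xs) = (Suc pc, X(i := X (nat (X j))), xs)"
| "exec (Store i j) (pc, X, xs) = (Suc pc, X(nat (X i) := X j), xs)"
| "exec (Read i) (pc, X, []) = (Suc pc, X(i := 0), [])"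
| "exec (Read i) (pc, X, x # xs) = (Suc pc, X(i := x), xs)"
| "exec (JumpPos j l) (pc, X, xs) = (if X j > 0 then l else Suc pc, X, xs)"
| "exec (Halt b) (pc, X, xs) = (pc, X, xs)"

definition step :: "instr list \<Rightarrow> config \<Rightarrow> config" where
  "step P cf = (if fst cf < length P then exec (P ! fst cf) cf else cf)"

definition answers_within :: "instr list \<Rightarrow> int list \<Rightarrow> nat \<Rightarrow> bool \<Rightarrow> bool" where
  "answers_within P xs T b \<longleftrightarrow>
     (let pc = fst ((step P ^^ T) (0, \<lambda>_. 0, xs)) in pc < length P \<and> P ! pc = Halt b)"

text \<open>Every integer is charged its binary length, and one more for its sign.\<close>

definition input_size :: "int list \<Rightarrow> nat" where
  "input_size xs = (\<Sum>x\<leftarrow>xs. nat (bitlen \<bar>x\<bar>) + 1)"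

text \<open>
  A decision problem is given by its set of instances, an encoding of the instances and the
  property to be decided. The algorithm only has to work on instances of the problem.
\<close>

definition polytime_decidable :: "('a \<Rightarrow> int list) \<Rightarrow> 'a set \<Rightarrow> ('a \<Rightarrow> bool) \<Rightarrow> bool" where
  "polytime_decidable enc I Q \<longleftrightarrow> (\<exists>(P :: instr list) (p :: nat poly). \<forall>x\<in>I.
     answers_within P (enc x) (poly p (input_size (enc x))) (Q x))"


section \<open>Encoding of graphs\<close>

text \<open>
  Input graphs have vertices \<open>0, \<dots>, n - 1\<close>. An instance \<open>(G, k)\<close> is encoded by \<open>n\<close>, \<open>k\<close>
  and the adjacency matrix of \<open>G\<close>, row by row.
\<close>

definition input_graph :: "nat pair_pre_digraph \<Rightarrow> bool" where
  "input_graph G \<longleftrightarrow> pair_graph G \<and> (\<exists>n. pverts G = {0..<n})"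

definition encode :: "nat pair_pre_digraph \<times> int \<Rightarrow> int list" where
  "encode = (\<lambda>(G, k). let n = card (pverts G) in
     int n # k # [if (u, v) \<in> parcs G then 1 else 0. u \<leftarrow> [0..<n], v \<leftarrow> [0..<n]])"

end

theory Submission
  imports Defs
begin

text \<open>
  A vertex whose neighbourhood is a clique is never interior to an induced path. Hence a
  convexly independent set of a starlike graph consists, up to enlarging it, of a set \<open>X\<close> of such
  simplicial vertices together with all vertices of a clique \<open>C\<close> that have no neighbour in \<open>X\<close>.
  Here \<open>C\<close> is either \<open>V\<^sub>0\<close> or the closed neighbourhood of a simplicial vertex, and the
  nonsimplicial neighbours of \<open>X\<close> lie in \<open>C\<close>. So for each of at most \<open>n\<close> cliques the rank asks for
  the maximum of \<open>|X| - |N(X) \<inter> C|\<close>, the deficiency of a bipartite graph. It is found by an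
  auction: each simplicial vertex bids for its cheapest neighbour in \<open>C\<close>, raising the price by one
  and evicting the previous holder, and gives up once its neighbours in \<open>C\<close> all cost \<open>n\<close>. The number of
  bidders that give up is the deficiency.
\<close>

section \<open>Convexly independent sets of starlike graphs\<close>

lemma set_vwalk_arcs: "set (vwalk_arcs p) = {(p ! i, p ! Suc i) | i. Suc i < length p}"
proof (induction p rule: vwalk_arcs.induct)
  case (3 x y xs)
  have "{((x # y # xs) ! i, (x # y # xs) ! Suc i) | i. Suc i < length (x # y # xs)}
    = insert (x, y) {((y # xs) ! i, (y # xs) ! Suc i) | i. Suc i < length (y # xs)}" (is "?L = insert _ ?R")
  proof (intro equalityI subsetI)
    fix z assume "z \<in> ?L"
    then obtain i where "z = ((x # y # xs) ! i, (x # y # xs) ! Suc i)" "Suc i < length (x # y # xs)"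
      by blast
    then show "z \<in> insert (x, y) ?R" by (cases i) auto
  next
    fix z assume "z \<in> insert (x, y) ?R"
    then consider "z = (x, y)" | i where "z = ((y # xs) ! i, (y # xs) ! Suc i)" "Suc i < length (y # xs)"
      by blast
    then show "z \<in> ?L"
    proof cases
      case 1 then show ?thesis by (intro CollectI exI[of _ 0]) auto
    next
      case 2 then show ?thesis by (intro CollectI exI[of _ "Suc i"]) auto
    qed
  qed
  with 3 show ?case by simp
qed auto

lemma induced_path_iff:
  "induced_path G p \<longleftrightarrow> p \<noteq> [] \<and> distinct p \<and> set p \<subseteq> pverts G \<and>
     (\<forall>i j. i < j \<longrightarrow> j < length p \<longrightarrow> (p ! i, p ! j) \<in> parcs G \<longleftrightarrow> j = Suc i)"
proof -
  have "set (vwalk_arcs p) \<subseteq> parcs G \<longleftrightarrow> (\<forall>i. Suc i < length p \<longrightarrow> (p ! i, p ! Suc i) \<in> parcs G)"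
    unfolding set_vwalk_arcs by blast
  then show ?thesis
    unfolding induced_path_def vpath_def vwalk_def by auto
qed

lemma notin_monophonic_hull:
  assumes "monophonic_convex G K" "S \<subseteq> K" "x \<notin> K"
  shows "x \<notin> monophonic_hull G S"
  using assms hull_minimal[of S K "monophonic_convex G"] unfolding monophonic_hull_def by blast

lemma induced_path_subset_hull:
  assumes "induced_path G p" "hd p \<in> S" "last p \<in> S"
  shows "set p \<subseteq> monophonic_hull G S"
  using assms unfolding monophonic_hull_def hull_def monophonic_convex_def by blast

lemma cliqueD: "clique G C \<Longrightarrow> u \<in> C \<Longrightarrow> v \<in> C \<Longrightarrow> u \<noteq> v \<Longrightarrow> (u, v) \<in> parcs G"
  unfolding clique_def by blast

lemma clique_subset: "clique G C \<Longrightarrow> D \<subseteq> C \<Longrightarrow> clique G D"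
  unfolding clique_def by blast

definition nonsimplicial :: "'a pair_pre_digraph \<Rightarrow> 'a set" where
  "nonsimplicial G = {v \<in> pverts G. \<not> clique G (closed_nbhd G v)}"

context pair_graph
begin

lemma adj_sym: "(u, v) \<in> parcs G \<Longrightarrow> (v, u) \<in> parcs G"
  using arcs_symmetric by blast

lemma adj_verts: "(u, v) \<in> parcs G \<Longrightarrow> u \<in> pverts G \<and> v \<in> pverts G"
  using in_arcsD1 in_arcsD2 by blast

lemma adj_neq: "(u, v) \<in> parcs G \<Longrightarrow> u \<noteq> v"
  using no_loops' by blast

lemma nonsimplicial_iff:
  "v \<in> nonsimplicial G \<longleftrightarrow> (\<exists>a b. (v, a) \<in> parcs G \<and> (v, b) \<in> parcs G \<and> a \<noteq> b \<and> (a, b) \<notin> parcs G)"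
  (is "_ \<longleftrightarrow> ?R")
proof
  assume "v \<in> nonsimplicial G"
  then obtain a b where ab: "v \<in> pverts G" "a \<in> closed_nbhd G v" "b \<in> closed_nbhd G v" "a \<noteq> b"
      "(a, b) \<notin> parcs G"
    unfolding nonsimplicial_def clique_def closed_nbhd_def using adj_verts by blast
  then have "a \<noteq> v" "b \<noteq> v"
    unfolding closed_nbhd_def using adj_sym by auto
  with ab show ?R unfolding closed_nbhd_def by auto
next
  assume ?R
  then show "v \<in> nonsimplicial G"
    unfolding nonsimplicial_def clique_def closed_nbhd_def using adj_verts by blast
qed

lemma clique_closed_nbhd:
  assumes "v \<in> pverts G" "v \<notin> nonsimplicial G"
  shows "clique G (closed_nbhd G v)"
  using assms unfolding nonsimplicial_def by blast

lemma interior_nonsimplicial: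
  assumes p: "induced_path G p" and i: "0 < i" "Suc i < length p"
  shows "p ! i \<in> nonsimplicial G"
proof -
  from p have d: "distinct p"
    and e: "\<And>i j. i < j \<Longrightarrow> j < length p \<Longrightarrow> (p ! i, p ! j) \<in> parcs G \<longleftrightarrow> j = Suc i"
    unfolding induced_path_iff by blast+
  have "(p ! (i - 1), p ! i) \<in> parcs G" "(p ! i, p ! Suc i) \<in> parcs G"
    "(p ! (i - 1), p ! Suc i) \<notin> parcs G"
    using e[of "i - 1" i] e[of i "Suc i"] e[of "i - 1" "Suc i"] i by auto
  moreover have "p ! (i - 1) \<noteq> p ! Suc i" using d i by (simp add: nth_eq_iff_index_eq)
  ultimately show ?thesis unfolding nonsimplicial_iff using adj_sym by blast
qed

lemma convex_minus_simplicial: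
  assumes "v \<notin> nonsimplicial G"
  shows "monophonic_convex G (pverts G - {v})"
  unfolding monophonic_convex_def
proof (intro conjI allI impI subsetI)
  fix p x assume p: "induced_path G p \<and> hd p \<in> pverts G - {v} \<and> last p \<in> pverts G - {v}"
    and x: "x \<in> set p"
  from p have ne: "p \<noteq> []" and sub: "set p \<subseteq> pverts G" by (auto simp: induced_path_iff)
  from x obtain i where i: "i < length p" "x = p ! i" by (metis in_set_conv_nth)
  have "x \<noteq> v"
  proof
    assume "x = v"
    with p i ne have "i \<noteq> 0" by (metis DiffE hd_conv_nth singletonI)
    moreover from \<open>x = v\<close> p i ne have "i \<noteq> length p - 1" by (metis DiffE last_conv_nth singletonI)
    ultimately have "0 < i" "Suc i < length p" using i by auto
    with interior_nonsimplicial[of p i] p i \<open>x = v\<close> assms show False by blast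
  qed
  with sub x show "x \<in> pverts G - {v}" by blast
qed auto

lemma convex_simplicials_Un_clique:
  assumes K: "clique G K" and X: "X \<subseteq> pverts G - nonsimplicial G"
    and N: "parcs G `` X \<inter> nonsimplicial G \<subseteq> K"
  shows "monophonic_convex G (X \<union> K)"
  unfolding monophonic_convex_def
proof (intro conjI allI impI)
  show "X \<union> K \<subseteq> pverts G" using K X unfolding clique_def by blast
next
  fix p assume p: "induced_path G p \<and> hd p \<in> X \<union> K \<and> last p \<in> X \<union> K"
  then have ne: "p \<noteq> []" and d: "distinct p"
    and e: "\<And>i j. i < j \<Longrightarrow> j < length p \<Longrightarrow> (p ! i, p ! j) \<in> parcs G \<longleftrightarrow> j = Suc i"
    by (auto simp: induced_path_iff)
  define m where "m = length p - 1"
  have m: "length p = Suc m" using ne m_def by (cases p) auto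
  have ends: "p ! 0 \<in> X \<union> K" "p ! m \<in> X \<union> K"
    using p ne m_def by (auto simp: hd_conv_nth last_conv_nth)
  have inner: "p ! i \<in> nonsimplicial G" if "0 < i" "i < m" for i
    using interior_nonsimplicial[of p i] p that m by auto
  have "p ! i \<in> X \<union> K" if i: "i \<le> m" for i
  proof (cases "i = 0 \<or> i = m")
    case True then show ?thesis using ends by auto
  next
    case False
    then have im: "0 < i" "i < m" using i by auto
    obtain a where a: "a \<le> 1" "a \<le> i" "p ! a \<in> K"
    proof (cases "p ! 0 \<in> K")
      case True then show ?thesis using that[of 0] by auto
    next
      case False
      then have "p ! 0 \<in> X" using ends by blast
      moreover have "(p ! 0, p ! 1) \<in> parcs G" using e[of 0 1] m im by auto
      ultimately have "p ! 1 \<in> K" using N inner[of 1] im by fastforce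
      then show ?thesis using that[of 1] im by auto
    qed
    obtain b where b: "m \<le> b + 1" "i \<le> b" "b \<le> m" "p ! b \<in> K"
    proof (cases "p ! m \<in> K")
      case True then show ?thesis using that[of m] im by auto
    next
      case False
      then have "p ! m \<in> X" using ends by blast
      have "(p ! (m - 1), p ! m) \<in> parcs G" using e[of "m - 1" m] m im by auto
      then have "p ! (m - 1) \<in> parcs G `` X" using \<open>p ! m \<in> X\<close> adj_sym by blast
      moreover have "p ! (m - 1) \<in> nonsimplicial G" using inner[of "m - 1"] im by auto
      ultimately have "p ! (m - 1) \<in> K" using N by blast
      then show ?thesis using that[of "m - 1"] im by auto
    qed
    have "b \<le> Suc a"
    proof (rule ccontr)
      assume "\<not> b \<le> Suc a"
      then have "a < b" by simp
      then have "p ! a \<noteq> p ! b" using d b m by (simp add: nth_eq_iff_index_eq)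
      then have "(p ! a, p ! b) \<in> parcs G" using K a b unfolding clique_def by blast
      then show False using e[of a b] \<open>\<not> b \<le> Suc a\<close> b m by auto
    qed
    then have "i = a \<or> i = b" using a b by auto
    then show ?thesis using a b by auto
  qed
  then show "set p \<subseteq> X \<union> K" using m by (metis in_set_conv_nth less_Suc_eq_le subsetI)
qed

lemma convexly_independent_simplicials_Un:
  assumes C: "clique G C" and X: "X \<subseteq> pverts G - nonsimplicial G"
    and N: "parcs G `` X \<inter> nonsimplicial G \<subseteq> C"
  shows "convexly_independent G (X \<union> (C - parcs G `` X))" (is "convexly_independent G ?S")
  unfolding convexly_independent_def
proof (intro conjI ballI)
  show sub: "?S \<subseteq> pverts G" using C X unfolding clique_def by blast
  fix v assume v: "v \<in> ?S"
  show "v \<notin> monophonic_hull G (?S - {v})"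
  proof (cases "v \<in> nonsimplicial G")
    case False
    have "?S - {v} \<subseteq> pverts G - {v}" "v \<notin> pverts G - {v}" using sub by auto
    from notin_monophonic_hull[OF convex_minus_simplicial[OF False] this] show ?thesis .
  next
    case True
    define K where "K = (C - parcs G `` X - {v}) \<union> (parcs G `` X \<inter> nonsimplicial G)"
    have vX: "v \<notin> X" "v \<in> C" "v \<notin> parcs G `` X" using True X v by auto
    have "clique G K" using C N unfolding K_def clique_def by blast
    moreover have "parcs G `` X \<inter> nonsimplicial G \<subseteq> K" unfolding K_def by blast
    ultimately have "monophonic_convex G (X \<union> K)" using X convex_simplicials_Un_clique by blast
    moreover have "?S - {v} \<subseteq> X \<union> K" "v \<notin> X \<union> K" using vX unfolding K_def by auto
    ultimately show ?thesis by (rule notin_monophonic_hull)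
  qed
qed

lemma induced_path3:
  assumes "(x, t) \<in> parcs G" "(t, z) \<in> parcs G" "x \<noteq> z" "(x, z) \<notin> parcs G"
  shows "induced_path G [x, t, z]"
proof -
  have *: "([x, t, z] ! i, [x, t, z] ! j) \<in> parcs G \<longleftrightarrow> j = Suc i"
    if "i < j" "j < length [x, t, z]" for i j
  proof -
    from that have "i < j" "j < 3" by auto
    then consider "i = 0" "j = 1" | "i = 0" "j = 2" | "i = 1" "j = 2" by linarith
    then show ?thesis using assms by cases auto
  qed
  show ?thesis unfolding induced_path_iff
  proof (intro conjI allI impI)
    show "distinct [x, t, z]" using assms adj_neq by auto
    show "set [x, t, z] \<subseteq> pverts G" using assms adj_verts by auto
  qed (use * in auto)
qed

lemma induced_path4:
  assumes "(x, t) \<in> parcs G" "(t, a) \<in> parcs G" "(a, z) \<in> parcs G"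
    "(x, a) \<notin> parcs G" "(x, z) \<notin> parcs G" "(t, z) \<notin> parcs G" "x \<noteq> z" "x \<noteq> a" "t \<noteq> z"
  shows "induced_path G [x, t, a, z]"
proof -
  have *: "([x, t, a, z] ! i, [x, t, a, z] ! j) \<in> parcs G \<longleftrightarrow> j = Suc i"
    if "i < j" "j < length [x, t, a, z]" for i j
  proof -
    from that have "i < j" "j < 4" by auto
    then consider "i = 0" "j = 1" | "i = 0" "j = 2" | "i = 0" "j = 3"
      | "i = 1" "j = 2" | "i = 1" "j = 3" | "i = 2" "j = 3" by linarith
    then show ?thesis using assms by cases (auto simp: numeral_3_eq_3)
  qed
  show ?thesis unfolding induced_path_iff
  proof (intro conjI allI impI)
    show "distinct [x, t, a, z]" using assms adj_neq by auto
    show "set [x, t, a, z] \<subseteq> pverts G" using assms adj_verts by auto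
  qed (use * in auto)
qed

lemma independent_not_between:
  assumes "convexly_independent G S" "t \<in> S" "induced_path G p" "t \<in> set p"
    "hd p \<in> S - {t}" "last p \<in> S - {t}"
  shows False
  using assms induced_path_subset_hull[of G p "S - {t}"] unfolding convexly_independent_def by blast

end

text \<open>If no simplicial vertex lies in \<open>V\<^sub>0\<close>, then \<open>V\<^sub>0\<close> is the set of nonsimplicial vertices.\<close>

definition core :: "'a pair_pre_digraph \<Rightarrow> 'a \<Rightarrow> 'a set" where
  "core G v = (if v \<in> nonsimplicial G then nonsimplicial G else closed_nbhd G v)"

definition satellites :: "'a pair_pre_digraph \<Rightarrow> 'a \<Rightarrow> 'a set" where
  "satellites G v = {u \<in> pverts G - nonsimplicial G - core G v.
     parcs G `` {u} \<inter> nonsimplicial G \<subseteq> core G v}"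

locale starlike_graph = pair_graph +
  fixes \<V> V\<^sub>0
  assumes partition: "partition_on (pverts G) \<V>"
    and cliques: "C \<in> \<V> \<Longrightarrow> clique G C"
    and V0: "V\<^sub>0 \<in> \<V>"
    and V0_max: "maximal_clique G V\<^sub>0"
    and twins: "W \<in> \<V> - {V\<^sub>0} \<Longrightarrow> u \<in> W \<Longrightarrow> v \<in> W \<Longrightarrow> closed_nbhd G u - W = closed_nbhd G v - W"
    and attached: "W \<in> \<V> - {V\<^sub>0} \<Longrightarrow> v \<in> W \<Longrightarrow> closed_nbhd G v - W \<subset> V\<^sub>0"
begin

lemma clique_V0: "clique G V\<^sub>0" using V0 cliques by blast

lemma V0_subset: "V\<^sub>0 \<subseteq> pverts G" using clique_V0 unfolding clique_def by blast

lemma V0_nonempty: "V\<^sub>0 \<noteq> {}" using partition V0 unfolding partition_on_def by blast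

lemma outside_part:
  assumes "x \<in> pverts G - V\<^sub>0"
  obtains W where "W \<in> \<V> - {V\<^sub>0}" "x \<in> W" "W \<inter> V\<^sub>0 = {}"
proof -
  obtain W where "W \<in> \<V>" "x \<in> W" using assms partition unfolding partition_on_def by blast
  moreover have "W \<noteq> V\<^sub>0" using assms calculation by blast
  moreover have "W \<inter> V\<^sub>0 = {}"
    using partition calculation V0 unfolding partition_on_def disjoint_def by blast
  ultimately show ?thesis using that by blast
qed

lemma nonsimplicial_subset_V0: "nonsimplicial G \<subseteq> V\<^sub>0"
proof
  fix x assume x: "x \<in> nonsimplicial G"
  show "x \<in> V\<^sub>0"
  proof (rule ccontr)
    assume "x \<notin> V\<^sub>0"
    with x have xo: "x \<in> pverts G - V\<^sub>0" unfolding nonsimplicial_def by blast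
    then obtain W where W: "W \<in> \<V> - {V\<^sub>0}" "x \<in> W" "W \<inter> V\<^sub>0 = {}" using outside_part by metis
    have sub: "closed_nbhd G x \<subseteq> W \<union> V\<^sub>0" using attached[OF W(1,2)] by blast
    have "(a, b) \<in> parcs G" if ab: "(x, a) \<in> parcs G" "(x, b) \<in> parcs G" "a \<noteq> b" for a b
    proof -
      have in_nbhd: "a \<in> closed_nbhd G x" "b \<in> closed_nbhd G x" using ab unfolding closed_nbhd_def by auto
      have "(c, d) \<in> parcs G" if "c \<in> W" "d \<in> closed_nbhd G x" "c \<noteq> d" for c d
      proof (cases "d \<in> W")
        case True then show ?thesis using that cliques[of W] W unfolding clique_def by blast
      next
        case False
        then have "d \<in> closed_nbhd G c" using twins[OF W(1,2) \<open>c \<in> W\<close>] that by blast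
        then show ?thesis using that unfolding closed_nbhd_def by auto
      qed
      note * = this
      show ?thesis
      proof (cases "a \<in> W")
        case True then show ?thesis using * in_nbhd ab by blast
      next
        case False
        show ?thesis
        proof (cases "b \<in> W")
          case True then show ?thesis using *[of b a] in_nbhd ab adj_sym by blast
        next
          case False
          then have "a \<in> V\<^sub>0" "b \<in> V\<^sub>0" using sub in_nbhd \<open>a \<notin> W\<close> by auto
          then show ?thesis using clique_V0 ab unfolding clique_def by blast
        qed
      qed
    qed
    then show False using x unfolding nonsimplicial_iff by blast
  qed
qed

lemma clique_core:
  assumes "v \<in> pverts G"
  shows "clique G (core G v)"
  using assms clique_closed_nbhd clique_subset[OF clique_V0 nonsimplicial_subset_V0]
  unfolding core_def by simp

lemma V0_core:
  obtains v where "v \<in> pverts G" "core G v = V\<^sub>0"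
proof (cases "V\<^sub>0 \<subseteq> nonsimplicial G")
  case True
  then obtain v where v: "v \<in> V\<^sub>0" "v \<in> nonsimplicial G" using V0_nonempty by blast
  with True nonsimplicial_subset_V0 have "core G v = V\<^sub>0" unfolding core_def by auto
  with v V0_subset that show ?thesis by blast
next
  case False
  then obtain v where v: "v \<in> V\<^sub>0" "v \<notin> nonsimplicial G" by blast
  have "clique G (closed_nbhd G v)" using v V0_subset clique_closed_nbhd by blast
  moreover have "V\<^sub>0 \<subseteq> closed_nbhd G v"
    using cliqueD[OF clique_V0 v(1)] unfolding closed_nbhd_def by blast
  ultimately have "closed_nbhd G v = V\<^sub>0" using V0_max unfolding maximal_clique_def by blast
  with v V0_subset that show ?thesis unfolding core_def by auto
qed

lemma independent_satellites:
  assumes ind: "convexly_independent G S"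
  obtains v X where "v \<in> pverts G" "X \<subseteq> satellites G v" "S \<subseteq> X \<union> (core G v - parcs G `` X)"
proof (cases "\<exists>x \<in> S - V\<^sub>0. \<exists>t \<in> S \<inter> V\<^sub>0. (x, t) \<in> parcs G")
  case False
  obtain v where v: "v \<in> pverts G" "core G v = V\<^sub>0" using V0_core .
  have "S - V\<^sub>0 \<subseteq> satellites G v"
    using ind v nonsimplicial_subset_V0 unfolding satellites_def convexly_independent_def by auto
  moreover have "S \<subseteq> (S - V\<^sub>0) \<union> (core G v - parcs G `` (S - V\<^sub>0))" using v False by blast
  ultimately show ?thesis using that v by blast
next
  case True
  then obtain x t where x: "x \<in> S" "x \<notin> V\<^sub>0" and t: "t \<in> S" "t \<in> V\<^sub>0" and xt: "(x, t) \<in> parcs G"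
    by blast
  have S: "S \<subseteq> pverts G" using ind unfolding convexly_independent_def by blast
  have xns: "x \<notin> nonsimplicial G" using x nonsimplicial_subset_V0 by blast
  then have core_x: "core G x = closed_nbhd G x" unfolding core_def by simp
  have V0_x: "z \<in> closed_nbhd G x" if z: "z \<in> S" "z \<in> V\<^sub>0" for z
  proof (rule ccontr)
    assume nz: "z \<notin> closed_nbhd G x"
    then have "z \<noteq> t" using xt unfolding closed_nbhd_def by auto
    then have "(t, z) \<in> parcs G" using cliqueD[OF clique_V0 t(2) z(2)] by metis
    then have "induced_path G [x, t, z]"
      using xt nz by (intro induced_path3) (auto simp: closed_nbhd_def)
    from independent_not_between[OF ind t(1) this] show False
      using x t z \<open>z \<noteq> t\<close> by auto
  qed
  have nbhd_x: "parcs G `` {z} \<inter> V\<^sub>0 \<subseteq> closed_nbhd G x" if z: "z \<in> S" "z \<notin> closed_nbhd G x" for z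
  proof
    fix a assume a: "a \<in> parcs G `` {z} \<inter> V\<^sub>0"
    show "a \<in> closed_nbhd G x"
    proof (rule ccontr)
      assume na: "a \<notin> closed_nbhd G x"
      have "z \<notin> V\<^sub>0" using V0_x z by blast
      with t have tz: "t \<noteq> z" by blast
      have ta: "(t, a) \<in> parcs G"
        using cliqueD[OF clique_V0 t(2), of a] a na xt unfolding closed_nbhd_def by blast
      have "induced_path G [x, t, z] \<or> induced_path G [x, t, a, z]"
      proof (cases "(t, z) \<in> parcs G")
        case True
        then have "induced_path G [x, t, z]"
          using xt z by (intro induced_path3) (auto simp: closed_nbhd_def)
        then show ?thesis ..
      next
        case False
        then have "induced_path G [x, t, a, z]"
          using xt ta a na z tz adj_sym by (intro induced_path4) (auto simp: closed_nbhd_def)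
        then show ?thesis ..
      qed
      then show False
        using independent_not_between[OF ind t(1)] x t z tz by fastforce
    qed
  qed
  let ?X = "S - closed_nbhd G x"
  have "?X \<subseteq> satellites G x"
  proof
    fix z assume z: "z \<in> ?X"
    then have "z \<notin> nonsimplicial G" using V0_x nonsimplicial_subset_V0 by blast
    moreover have "parcs G `` {z} \<inter> nonsimplicial G \<subseteq> closed_nbhd G x"
      using nbhd_x[of z] z nonsimplicial_subset_V0 by blast
    ultimately show "z \<in> satellites G x" using z S unfolding satellites_def core_x by blast
  qed
  moreover have "s \<notin> parcs G `` ?X" if s: "s \<in> S" "s \<in> closed_nbhd G x" for s
  proof
    assume "s \<in> parcs G `` ?X"
    then obtain z where z: "z \<in> S" "z \<notin> closed_nbhd G x" "(z, s) \<in> parcs G" by blast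
    have "z \<notin> V\<^sub>0" using V0_x z by blast
    have sx: "s \<noteq> x" using z adj_sym unfolding closed_nbhd_def by blast
    have xs: "(x, s) \<in> parcs G" using s sx unfolding closed_nbhd_def by auto
    have "induced_path G [x, s, z]"
      using xs z adj_sym by (intro induced_path3) (auto simp: closed_nbhd_def)
    from independent_not_between[OF ind s(1) this] show False
      using x s z sx adj_neq by auto
  qed
  ultimately show ?thesis using that[of x ?X] x S core_x by blast
qed

end

lemma finite_independent_cards:
  assumes "finite (pverts G)"
  shows "finite {card S | S. convexly_independent G S}"
proof -
  have "{S. convexly_independent G S} \<subseteq> Pow (pverts G)" unfolding convexly_independent_def by blast
  then have "finite (card ` {S. convexly_independent G S})"
    using assms finite_subset by blast
  moreover have "card ` {S. convexly_independent G S} = {card S | S. convexly_independent G S}" by blast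
  ultimately show ?thesis by simp
qed

theorem monophonic_rank_ge_iff:
  assumes G: "pair_graph G" and star: "starlike G"
  shows "k \<le> monophonic_rank G \<longleftrightarrow>
    (\<exists>v \<in> pverts G. \<exists>X \<subseteq> satellites G v. k \<le> card X + card (core G v - parcs G `` X))"
proof -
  interpret pair_graph G by fact
  obtain \<V> V\<^sub>0 where V: "partition_on (pverts G) \<V> \<and> (\<forall>C\<in>\<V>. clique G C) \<and>
     V\<^sub>0 \<in> \<V> \<and> maximal_clique G V\<^sub>0 \<and>
     (\<forall>W \<in> \<V> - {V\<^sub>0}. \<forall>u\<in>W. \<forall>v\<in>W.
        closed_nbhd G u - W = closed_nbhd G v - W \<and> closed_nbhd G v - W \<subset> V\<^sub>0)"
    using star unfolding starlike_def by (elim exE) (rule that)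
  interpret starlike_graph G \<V> V\<^sub>0
    using V by unfold_locales blast+
  let ?R = "{card S | S. convexly_independent G S}"
  have fin: "finite ?R" using finite_independent_cards pair_finite_verts by blast
  have "convexly_independent G {}" unfolding convexly_independent_def by blast
  then have ne: "?R \<noteq> {}" by blast
  have rank: "k \<le> monophonic_rank G \<longleftrightarrow> (\<exists>S. convexly_independent G S \<and> k \<le> card S)"
    unfolding monophonic_rank_def using Max_ge_iff[OF fin ne] by auto
  have fin_core: "finite (core G v)" if "v \<in> pverts G" for v
    using clique_core[OF that] pair_finite_verts finite_subset unfolding clique_def by blast
  have fin_sat: "finite X" if "X \<subseteq> satellites G v" for X v
    using that pair_finite_verts finite_subset[of X "pverts G"] unfolding satellites_def by blast
  show ?thesis unfolding rank
  proof
    assume "\<exists>S. convexly_independent G S \<and> k \<le> card S"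
    then obtain S where S: "convexly_independent G S" "k \<le> card S" by blast
    obtain v X where v: "v \<in> pverts G" "X \<subseteq> satellites G v" "S \<subseteq> X \<union> (core G v - parcs G `` X)"
      using independent_satellites[OF S(1)] .
    have "card S \<le> card (X \<union> (core G v - parcs G `` X))"
      using v fin_core fin_sat by (intro card_mono) auto
    also have "\<dots> \<le> card X + card (core G v - parcs G `` X)" by (rule card_Un_le)
    finally show "\<exists>v \<in> pverts G. \<exists>X \<subseteq> satellites G v. k \<le> card X + card (core G v - parcs G `` X)"
      using S(2) v(1,2) order.trans by blast
  next
    assume "\<exists>v \<in> pverts G. \<exists>X \<subseteq> satellites G v. k \<le> card X + card (core G v - parcs G `` X)"
    then obtain v X where v: "v \<in> pverts G" "X \<subseteq> satellites G v"
      "k \<le> card X + card (core G v - parcs G `` X)" by blast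
    have "convexly_independent G (X \<union> (core G v - parcs G `` X))"
      using v clique_core unfolding satellites_def
      by (intro convexly_independent_simplicials_Un) auto
    moreover have "card (X \<union> (core G v - parcs G `` X)) = card X + card (core G v - parcs G `` X)"
      using v fin_core fin_sat unfolding satellites_def by (intro card_Un_disjoint) auto
    ultimately show "\<exists>S. convexly_independent G S \<and> k \<le> card S" using v by metis
  qed
qed

section \<open>Bipartite deficiency by auction\<close>

text \<open>Satellites bid for neighbours: \<open>pr\<close> are the prices, \<open>ow c = Suc u\<close> says that \<open>u\<close> holds \<open>c\<close>
  and \<open>ow c = 0\<close> that nobody does, \<open>u\<close> still has to bid iff \<open>st (Suc u) \<noteq> 0\<close>, and \<open>g\<close> counts
  the bidders that have given up. The slot \<open>st 0\<close> is junk.\<close>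

definition losers :: "nat set \<Rightarrow> nat set \<Rightarrow> (nat \<Rightarrow> nat) \<Rightarrow> (nat \<Rightarrow> nat) \<Rightarrow> nat set" where
  "losers U C st ow = {u \<in> U. st (Suc u) = 0 \<and> Suc u \<notin> ow ` C}"

definition auction :: "nat set \<Rightarrow> nat set \<Rightarrow> (nat \<Rightarrow> nat \<Rightarrow> bool) \<Rightarrow> nat \<Rightarrow>
    (nat \<Rightarrow> nat) \<Rightarrow> (nat \<Rightarrow> nat) \<Rightarrow> (nat \<Rightarrow> nat) \<Rightarrow> nat \<Rightarrow> bool" where
  "auction U C E L st pr ow g \<longleftrightarrow>
     (\<forall>u. u \<notin> U \<longrightarrow> st (Suc u) = 0) \<and>
     (\<forall>c\<in>C. pr c \<le> L) \<and>
     (\<forall>c\<in>C. ow c = 0 \<longrightarrow> pr c = 0) \<and>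
     (\<forall>c\<in>C. \<forall>d\<in>C. ow c = ow d \<longrightarrow> ow c \<noteq> 0 \<longrightarrow> c = d) \<and>
     (\<forall>c\<in>C. \<forall>u. ow c = Suc u \<longrightarrow> u \<in> U \<and> st (Suc u) = 0 \<and> E u c \<and> (\<forall>d\<in>C. E u d \<longrightarrow> pr c \<le> Suc (pr d))) \<and>
     (\<forall>u\<in>losers U C st ow. \<forall>c\<in>C. E u c \<longrightarrow> L \<le> pr c) \<and>
     g = card (losers U C st ow)"

lemma auction_init:
  assumes "\<And>u. st (Suc u) = (if u \<in> U then 1 else 0)" "\<And>c. c \<in> C \<Longrightarrow> pr c = 0" "\<And>c. c \<in> C \<Longrightarrow> ow c = 0"
  shows "auction U C E L st pr ow 0"
proof -
  have "losers U C st ow = {}" using assms unfolding losers_def by auto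
  then show ?thesis using assms unfolding auction_def by auto
qed

lemma auction_bid:
  assumes inv: "auction U C E L st pr ow g"
    and u: "u \<in> U" "st (Suc u) \<noteq> 0" and c: "c \<in> C" "E u c" "pr c < L"
    and min: "\<And>d. d \<in> C \<Longrightarrow> E u d \<Longrightarrow> pr c \<le> pr d"
  shows "auction U C E L (st(Suc u := 0, ow c := 1)) (pr(c := Suc (pr c))) (ow(c := Suc u)) g"
proof -
  let ?st = "st(Suc u := 0, ow c := 1)" and ?pr = "pr(c := Suc (pr c))" and ?ow = "ow(c := Suc u)"
  have own: "d \<in> C \<Longrightarrow> ow d \<noteq> Suc u" for d using inv u unfolding auction_def by auto
  have inj: "d \<in> C \<Longrightarrow> ow c = ow d \<Longrightarrow> ow c \<noteq> 0 \<Longrightarrow> c = d" for d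
    using inv c unfolding auction_def by blast
  have holder: "w \<in> U" if "ow c = Suc w" for w using inv c that unfolding auction_def by blast
  have los: "losers U C ?st ?ow = losers U C st ow"
  proof (intro equalityI subsetI)
    fix w assume w: "w \<in> losers U C ?st ?ow"
    then have "w \<noteq> u" using c unfolding losers_def by auto
    moreover have "Suc w \<noteq> ow c" using w unfolding losers_def by (auto split: if_splits)
    ultimately show "w \<in> losers U C st ow" using w unfolding losers_def
      by (auto simp: image_iff split: if_splits)
  next
    fix w assume w: "w \<in> losers U C st ow"
    then have "w \<noteq> u" using u unfolding losers_def by auto
    moreover have "Suc w \<noteq> ow c" using w c unfolding losers_def by auto
    ultimately show "w \<in> losers U C ?st ?ow" using w unfolding losers_def by auto
  qed
  have "w \<in> U \<and> ?st (Suc w) = 0 \<and> E w d \<and> (\<forall>e\<in>C. E w e \<longrightarrow> ?pr d \<le> Suc (?pr e))"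
    if d: "d \<in> C" "?ow d = Suc w" for d w
  proof (cases "d = c")
    case True
    then show ?thesis using d u c min own[OF c(1)] by auto
  next
    case False
    then have "ow d = Suc w" using d by simp
    moreover have "Suc w \<noteq> ow c" using inj[OF d(1)] False calculation by auto
    moreover have "w \<in> U" "st (Suc w) = 0" "E w d" "\<And>e. e \<in> C \<Longrightarrow> E w e \<Longrightarrow> pr d \<le> Suc (pr e)"
      using inv d(1) \<open>ow d = Suc w\<close> unfolding auction_def by blast+
    ultimately show ?thesis using False by (auto intro: le_SucI)
  qed
  moreover have "?st (Suc w) = 0" if "w \<notin> U" for w
    using inv that holder[of w] unfolding auction_def by auto
  moreover have "d = e" if "d \<in> C" "e \<in> C" "?ow d = ?ow e" "?ow d \<noteq> 0" for d e
    using that own[of d] own[of e] inv unfolding auction_def by (auto split: if_splits)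
  moreover have "?pr d \<le> L" "?ow d = 0 \<longrightarrow> ?pr d = 0" if "d \<in> C" for d
    using that inv c unfolding auction_def by auto
  moreover have "L \<le> ?pr d" if "w \<in> losers U C st ow" "d \<in> C" "E w d" for w d
    using that inv unfolding auction_def by (auto intro: le_SucI)
  moreover have "g = card (losers U C st ow)" using inv unfolding auction_def by blast
  ultimately show ?thesis unfolding auction_def los by blast
qed

lemma auction_give_up:
  assumes inv: "auction U C E L st pr ow g" and U: "finite U"
    and u: "u \<in> U" "st (Suc u) \<noteq> 0" and c: "\<And>c. c \<in> C \<Longrightarrow> E u c \<Longrightarrow> L \<le> pr c"
  shows "auction U C E L (st(Suc u := 0)) pr ow (Suc g)"
proof -
  have "Suc u \<notin> ow ` C" using inv u unfolding auction_def by (metis image_iff)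
  then have "losers U C (st(Suc u := 0)) ow = insert u (losers U C st ow)" "u \<notin> losers U C st ow"
    using u unfolding losers_def by auto
  moreover have "finite (losers U C st ow)" using U unfolding losers_def by auto
  ultimately show ?thesis using inv c unfolding auction_def by auto
qed

lemma auction_progress_bound:
  assumes inv: "auction U C E L st pr ow g" and fin: "finite U" and u: "u \<in> U" "st (Suc u) \<noteq> 0"
  shows "sum pr C + g < card C * L + card U"
proof -
  have "losers U C st ow \<subseteq> U - {u}" using u unfolding losers_def by auto
  then have "g \<le> card (U - {u})" using inv fin unfolding auction_def by (auto intro: card_mono)
  also have "\<dots> < card U" using fin u by (intro card_Diff1_less)
  finally have "g < card U" .
  moreover have "sum pr C \<le> card C * L"
    using inv sum_bounded_above[of C pr L] unfolding auction_def by simp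
  ultimately show ?thesis by simp
qed

text \<open>Some price \<open>l\<close> with \<open>0 < l \<le> L\<close> does not occur. The sought set consists of the bidders all
  of whose neighbours cost more than \<open>l\<close>: it contains the losers, and the holders of all nodes
  that cost more than \<open>l\<close>.\<close>

lemma auction_certificate:
  assumes inv: "auction U C E L st pr ow g" and fin: "finite U" "finite C"
    and idle: "\<And>u. u \<in> U \<Longrightarrow> st (Suc u) = 0" and L: "U \<noteq> {} \<Longrightarrow> card C < L"
  shows "\<exists>X\<subseteq>U. g + card {c \<in> C. \<exists>u\<in>X. E u c} \<le> card X"
proof (cases "U = {}")
  case True
  then show ?thesis using inv unfolding auction_def losers_def by auto
next
  case False
  have "card (pr ` C) \<le> card C" using fin by (rule_tac card_image_le)
  also have "\<dots> < card {0<..L}" using L False by simp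
  finally have "\<not> {0<..L} \<subseteq> pr ` C" using fin card_mono[of "pr ` C" "{0<..L}"] by auto
  then obtain l where l: "0 < l" "l \<le> L" "l \<notin> pr ` C" by (meson greaterThanAtMost_iff subsetI)
  define D where "D = {c \<in> C. l < pr c}"
  define X where "X = {u \<in> U. \<forall>c\<in>C. E u c \<longrightarrow> c \<in> D}"
  let ?F = "losers U C st ow"
  let ?h = "\<lambda>c. ow c - 1"
  have D: "ow c = Suc (?h c) \<and> ?h c \<in> X" if "c \<in> D" for c
  proof -
    have c: "c \<in> C" "l < pr c" using that unfolding D_def by auto
    then have "ow c \<noteq> 0" using inv unfolding auction_def by fastforce
    then have ow: "ow c = Suc (?h c)" by simp
    then have h: "?h c \<in> U" "\<forall>d\<in>C. E (?h c) d \<longrightarrow> pr c \<le> Suc (pr d)"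
      using inv c unfolding auction_def by blast+
    have "d \<in> D" if "d \<in> C" "E (?h c) d" for d
    proof -
      have "l \<le> pr d" using h c that by fastforce
      moreover have "l \<noteq> pr d" using l that by auto
      ultimately show ?thesis using that unfolding D_def by auto
    qed
    then show ?thesis using ow h unfolding X_def by auto
  qed
  have inj: "inj_on ?h D"
  proof (rule inj_onI)
    fix c d assume cd: "c \<in> D" "d \<in> D" "?h c = ?h d"
    then have "ow c = ow d" "ow c \<noteq> 0" using D by (metis, metis Suc_neq_Zero)
    then show "c = d" using inv cd unfolding auction_def D_def by blast
  qed
  have "c \<in> D" if "u \<in> ?F" "c \<in> C" "E u c" for u c
  proof -
    have "L \<le> pr c" using inv that unfolding auction_def by blast
    moreover have "l \<noteq> pr c" using l that by auto
    ultimately show ?thesis using that l unfolding D_def by auto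
  qed
  then have F: "?F \<subseteq> X" unfolding X_def losers_def by auto
  have disj: "?F \<inter> ?h ` D = {}"
  proof -
    have "?h c \<notin> ?F" if "c \<in> D" for c
    proof -
      have "Suc (?h c) \<in> ow ` C" using D[OF that] that unfolding D_def by force
      then show ?thesis unfolding losers_def by blast
    qed
    then show ?thesis by blast
  qed
  have finX: "finite X" using fin unfolding X_def by simp
  have finD: "finite D" using fin unfolding D_def by simp
  have "g + card D = card ?F + card (?h ` D)"
    using inv card_image[OF inj] unfolding auction_def by simp
  also have "\<dots> = card (?F \<union> ?h ` D)"
    using disj F finX finD finite_subset by (intro card_Un_disjoint[symmetric]) auto
  also have "\<dots> \<le> card X" using F D finX by (intro card_mono) auto
  finally have "g + card D \<le> card X" .
  moreover have "card {c \<in> C. \<exists>u\<in>X. E u c} \<le> card D" using finD unfolding X_def by (intro card_mono) auto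
  ultimately show ?thesis using X_def by (intro exI[of _ X]) auto
qed

lemma auction_upper:
  assumes inv: "auction U C E L st pr ow g" and fin: "finite U" "finite C"
    and idle: "\<And>u. u \<in> U \<Longrightarrow> st (Suc u) = 0" and X: "X \<subseteq> U"
  shows "card X \<le> g + card {c \<in> C. \<exists>u\<in>X. E u c}"
proof -
  let ?F = "losers U C st ow" and ?N = "{c \<in> C. \<exists>u\<in>X. E u c}"
  have "X \<subseteq> ?F \<union> (\<lambda>c. ow c - 1) ` ?N"
  proof
    fix u assume u: "u \<in> X"
    show "u \<in> ?F \<union> (\<lambda>c. ow c - 1) ` ?N"
    proof (cases "Suc u \<in> ow ` C")
      case True
      then obtain c where c: "c \<in> C" "ow c = Suc u" by auto
      then have "E u c" using inv unfolding auction_def by blast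
      then show ?thesis using c u by force
    next
      case False
      then show ?thesis using idle X u unfolding losers_def by auto
    qed
  qed
  moreover have finF: "finite ?F" using fin unfolding losers_def by simp
  ultimately have "card X \<le> card (?F \<union> (\<lambda>c. ow c - 1) ` ?N)" using fin by (intro card_mono) auto
  also have "\<dots> \<le> card ?F + card ((\<lambda>c. ow c - 1) ` ?N)" by (rule card_Un_le)
  also have "\<dots> \<le> card ?F + card ?N" using fin by (intro add_mono card_image_le) auto
  finally show ?thesis using inv unfolding auction_def by simp
qed

lemma auction_result:
  assumes inv: "auction U C E L st pr ow g" and fin: "finite U" "finite C"
    and idle: "\<And>u. u \<in> U \<Longrightarrow> st (Suc u) = 0" and L: "U \<noteq> {} \<Longrightarrow> card C < L"
  shows "k \<le> card C + g \<longleftrightarrow> (\<exists>X\<subseteq>U. k \<le> card X + card (C - {c. \<exists>u\<in>X. E u c}))"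
proof -
  have C: "card C = card {c \<in> C. \<exists>u\<in>X. E u c} + card (C - {c. \<exists>u\<in>X. E u c})" for X
  proof -
    have "card ({c \<in> C. \<exists>u\<in>X. E u c} \<union> (C - {c. \<exists>u\<in>X. E u c}))
      = card {c \<in> C. \<exists>u\<in>X. E u c} + card (C - {c. \<exists>u\<in>X. E u c})"
      using fin by (intro card_Un_disjoint) auto
    moreover have "{c \<in> C. \<exists>u\<in>X. E u c} \<union> (C - {c. \<exists>u\<in>X. E u c}) = C" by blast
    ultimately show ?thesis by simp
  qed
  show ?thesis
  proof
    assume k: "k \<le> card C + g"
    obtain X where "X \<subseteq> U" "g + card {c \<in> C. \<exists>u\<in>X. E u c} \<le> card X"
      using auction_certificate[OF assms] by blast
    then show "\<exists>X\<subseteq>U. k \<le> card X + card (C - {c. \<exists>u\<in>X. E u c})"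
      using k C[of X] by (intro exI[of _ X]) auto
  next
    assume "\<exists>X\<subseteq>U. k \<le> card X + card (C - {c. \<exists>u\<in>X. E u c})"
    then obtain X where "X \<subseteq> U" "k \<le> card X + card (C - {c. \<exists>u\<in>X. E u c})" by blast
    then show "k \<le> card C + g"
      using auction_upper[OF inv fin idle, of X] C[of X] by auto
  qed
qed

section \<open>Loop programs and their compilation\<close>

text \<open>
  A state assigns a number to each index of each array. Cell \<open>(r, x)\<close> is kept in register
  \<open>32 * x + r\<close>; array 31 holds the temporaries of expression evaluation, and array 30 is the
  unread input tape. Every loop runs \<open>s 0 0\<close> times, with its counter in cell \<open>(r, 0)\<close>, so that the
  running time is bounded by a polynomial read off from the program text.
\<close>

type_synonym state = "nat \<Rightarrow> nat \<Rightarrow> nat"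

datatype exp = Lit nat | Cell nat exp | Plus exp exp

datatype com =
    Skip
  | Assign nat exp exp
  | Input nat exp
  | Seq com com (infixr ";;" 60)
  | Cond exp exp com com
  | For nat com

fun eval :: "exp \<Rightarrow> state \<Rightarrow> nat" where
  "eval (Lit c) s = c"
| "eval (Cell r e) s = s r (eval e s)"
| "eval (Plus a b) s = eval a s + eval b s"

definition upd :: "state \<Rightarrow> nat \<Rightarrow> nat \<Rightarrow> nat \<Rightarrow> state" where
  "upd s r x v = s(r := (s r)(x := v))"

fun sem :: "com \<Rightarrow> state \<Rightarrow> state" where
  "sem Skip s = s"
| "sem (Assign r e a) s = upd s r (eval e s) (eval a s)"
| "sem (Input r e) s = (upd s r (eval e s) (s 30 0))(30 := \<lambda>i. s 30 (Suc i))"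
| "sem (c ;; d) s = sem d (sem c s)"
| "sem (Cond a b c d) s = (if eval a s < eval b s then sem c s else sem d s)"
| "sem (For r c) s = upd (fold (\<lambda>k s. sem c (upd s r 0 k)) [0..<s 0 0] s) r 0 (s 0 0)"

fun wf_exp :: "exp \<Rightarrow> bool" where
  "wf_exp (Lit c) = True"
| "wf_exp (Cell r e) = (r < 30 \<and> wf_exp e)"
| "wf_exp (Plus a b) = (wf_exp a \<and> wf_exp b)"

fun writes :: "com \<Rightarrow> nat set" where
  "writes Skip = {}"
| "writes (Assign r e a) = {r}"
| "writes (Input r e) = {r, 30}"
| "writes (c ;; d) = writes c \<union> writes d"
| "writes (Cond a b c d) = writes c \<union> writes d"
| "writes (For r c) = insert r (writes c)"

fun wf_com :: "com \<Rightarrow> bool" where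
  "wf_com Skip = True"
| "wf_com (Assign r e a) = (0 < r \<and> r < 30 \<and> wf_exp e \<and> wf_exp a)"
| "wf_com (Input r e) = (0 < r \<and> r < 30 \<and> wf_exp e)"
| "wf_com (c ;; d) = (wf_com c \<and> wf_com d)"
| "wf_com (Cond a b c d) = (wf_exp a \<and> wf_exp b \<and> wf_com c \<and> wf_com d)"
| "wf_com (For r c) = (0 < r \<and> r < 30 \<and> r \<notin> writes c \<and> wf_com c)"

lemma sem_not_writes: "r \<notin> writes c \<Longrightarrow> sem c s r = s r"
proof (induction c arbitrary: s)
  case (For q c)
  have "fold (\<lambda>k s. sem c (upd s q 0 k)) ks s r = s r" for ks
    using For by (induction ks rule: rev_induct) (auto simp: upd_def)
  then show ?case using For.prems by (simp add: upd_def)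
qed (auto simp: upd_def)

lemma wf_com_writes: "wf_com c \<Longrightarrow> 0 \<notin> writes c"
  by (induction c) auto

lemma sem_size: "wf_com c \<Longrightarrow> sem c s 0 = s 0"
  using sem_not_writes wf_com_writes by blast

definition addr :: "nat \<Rightarrow> nat \<Rightarrow> nat" where "addr r x = 32 * x + r"

lemma addr_eq_iff [simp]:
  assumes "r < 32" "q < 32"
  shows "addr r x = addr q y \<longleftrightarrow> r = q \<and> x = y"
proof
  assume "addr r x = addr q y"
  then have "(32 * x + r) mod 32 = (32 * y + q) mod 32" "(32 * x + r) div 32 = (32 * y + q) div 32"
    unfolding addr_def by auto
  then show "r = q \<and> x = y" using assms by simp
qed simp

abbreviation tmp :: "nat \<Rightarrow> nat" where "tmp t \<equiv> addr 31 t"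

fun compile_exp :: "exp \<Rightarrow> nat \<Rightarrow> instr list" and compile_addr :: "nat \<Rightarrow> exp \<Rightarrow> nat \<Rightarrow> instr list" where
  "compile_exp (Lit c) t = [Const (tmp t) (int c)]"
| "compile_exp (Cell r e) t = compile_addr r e t @ [Load (tmp t) (tmp t)]"
| "compile_exp (Plus a b) t = compile_exp a t @ compile_exp b (Suc t) @ [Add (tmp t) (tmp t) (tmp (Suc t))]"
| "compile_addr r e t = compile_exp e t @ replicate 5 (Add (tmp t) (tmp t) (tmp t)) @
     [Const (tmp (Suc t)) (int r), Add (tmp t) (tmp t) (tmp (Suc t))]"

declare compile_addr.simps [simp del]

fun code_len :: "com \<Rightarrow> nat" where
  "code_len Skip = 0"
| "code_len (Assign r e a) = length (compile_addr r e 0) + length (compile_exp a 1) + 1"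
| "code_len (Input r e) = length (compile_addr r e 0) + 2"
| "code_len (c ;; d) = code_len c + code_len d"
| "code_len (Cond a b c d) = length (compile_exp a 0) + length (compile_exp b 1) + 4 + code_len c + code_len d"
| "code_len (For r c) = code_len c + 8"

fun compile :: "com \<Rightarrow> nat \<Rightarrow> instr list" where
  "compile Skip l = []"
| "compile (Assign r e a) l = compile_addr r e 0 @ compile_exp a 1 @ [Store (tmp 0) (tmp 1)]"
| "compile (Input r e) l = compile_addr r e 0 @ [Read (tmp 1), Store (tmp 0) (tmp 1)]"
| "compile (c ;; d) l = compile c l @ compile d (l + code_len c)"
| "compile (Cond a b c d) l = (let m = l + length (compile_exp a 0) + length (compile_exp b 1) in
     compile_exp a 0 @ compile_exp b 1 @ [Sub (tmp 0) (tmp 1) (tmp 0), JumpPos (tmp 0) (m + 4 + code_len d)] @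
     compile d (m + 2) @ [Const (tmp 0) 1, JumpPos (tmp 0) (m + 4 + code_len d + code_len c)] @
     compile c (m + 4 + code_len d))"
| "compile (For r c) l =
     [Const (addr r 0) 0, Sub (tmp 0) (addr 0 0) (addr r 0), JumpPos (tmp 0) (l + 5),
      Const (tmp 0) 1, JumpPos (tmp 0) (l + 8 + code_len c)] @
     compile c (l + 5) @
     [Const (tmp 0) 1, Add (addr r 0) (addr r 0) (tmp 0), JumpPos (tmp 0) (l + 1)]"

lemma length_compile: "length (compile c l) = code_len c"
  by (induction c arbitrary: l) (auto simp: Let_def)

fun time :: "com \<Rightarrow> nat poly" where
  "time Skip = 0"
| "time (Assign r e a) = [:code_len (Assign r e a):]"
| "time (Input r e) = [:code_len (Input r e):]"
| "time (c ;; d) = time c + time d"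
| "time (Cond a b c d) = [:length (compile_exp a 0) + length (compile_exp b 1) + 4:] + time c + time d"
| "time (For r c) = [:5:] + [:0, 1:] * (time c + [:5:])"

fun code_at :: "instr list \<Rightarrow> nat \<Rightarrow> instr list \<Rightarrow> bool" where
  "code_at P l [] = True"
| "code_at P l (i # is) = (l < length P \<and> P ! l = i \<and> code_at P (Suc l) is)"

lemma code_at_append [simp]: "code_at P l (is @ js) \<longleftrightarrow> code_at P l is \<and> code_at P (l + length is) js"
  by (induction "is" arbitrary: l) auto

lemma code_at_middle: "code_at (as @ is @ bs) (length as) is"
proof (induction "is" arbitrary: as)
  case (Cons i "is")
  from Cons[of "as @ [i]"] show ?case by simp
qed simp

definition reach :: "instr list \<Rightarrow> nat \<Rightarrow> config \<Rightarrow> config \<Rightarrow> bool" where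
  "reach P T cf cf' \<longleftrightarrow> (\<exists>t\<le>T. (step P ^^ t) cf = cf')"

lemma reach_trans:
  assumes "reach P T cf cf'" "reach P T' cf' cf''"
  shows "reach P (T + T') cf cf''"
proof -
  obtain t t' where t: "t \<le> T" "(step P ^^ t) cf = cf'" "t' \<le> T'" "(step P ^^ t') cf' = cf''"
    using assms unfolding reach_def by blast
  have "(step P ^^ (t' + t)) cf = cf''" unfolding funpow_add using t by simp
  with t show ?thesis unfolding reach_def by (intro exI[of _ "t' + t"]) auto
qed

lemma reach_mono: "reach P T cf cf' \<Longrightarrow> T \<le> T' \<Longrightarrow> reach P T' cf cf'"
  unfolding reach_def using order.trans by blast

lemma reach_refl: "reach P T cf cf"
  unfolding reach_def by (intro exI[of _ 0]) auto

lemma reach_step: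
  assumes "l < length P" "reach P T (exec (P ! l) (l, X, xs)) cf"
  shows "reach P (Suc T) (l, X, xs) cf"
proof -
  have "reach P 1 (l, X, xs) (exec (P ! l) (l, X, xs))"
    using assms(1) unfolding reach_def step_def by (intro exI[of _ 1]) auto
  from reach_trans[OF this assms(2)] show ?thesis by simp
qed

lemma reach_0I: "cf = cf' \<Longrightarrow> reach P 0 cf cf'"
  by (simp add: reach_refl)

lemmas reach_intros = reach_step reach_0I

definition represents :: "(nat \<Rightarrow> int) \<Rightarrow> int list \<Rightarrow> state \<Rightarrow> bool" where
  "represents X xs s \<longleftrightarrow> (\<forall>r<30. \<forall>x. X (addr r x) = int (s r x)) \<and>
     (\<forall>i. (if i < length xs then xs ! i else 0) = int (s 30 i))"

lemma addr_neq_tmp: "r < 31 \<Longrightarrow> addr r x \<noteq> tmp t"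
  by simp

lemma represents_tmp:
  assumes "represents X xs s" "\<And>a. (\<forall>t. a \<noteq> tmp t) \<Longrightarrow> X' a = X a"
  shows "represents X' xs s"
  unfolding represents_def
proof (intro conjI allI impI)
  fix r x :: nat assume r: "r < 30"
  then have "X' (addr r x) = X (addr r x)" by (intro assms(2) allI addr_neq_tmp) simp
  then show "X' (addr r x) = int (s r x)" using assms(1) r unfolding represents_def by simp
qed (use assms(1) in \<open>simp add: represents_def\<close>)

lemma represents_upd_tmp: "represents X xs s \<Longrightarrow> represents (X(tmp t := v)) xs s"
  by (erule represents_tmp) auto

lemma represents_upd:
  assumes "represents X xs s" "r < 30"
  shows "represents (X(addr r x := int v)) xs (upd s r x v)"
  using assms unfolding represents_def upd_def by auto

lemma represents_cell: "represents X xs s \<Longrightarrow> r < 30 \<Longrightarrow> X (addr r x) = int (s r x)"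
  unfolding represents_def by blast

lemma represents_pop:
  assumes "represents X xs s"
  shows "represents X (tl xs) (s(30 := \<lambda>i. s 30 (Suc i)))"
  unfolding represents_def
proof (intro conjI allI impI)
  fix i
  have "(if Suc i < length xs then xs ! Suc i else 0) = int (s 30 (Suc i))"
    using assms unfolding represents_def by blast
  then show "(if i < length (tl xs) then tl xs ! i else 0) = int ((s(30 := \<lambda>i. s 30 (Suc i))) 30 i)"
    by (cases xs) auto
qed (use assms in \<open>auto simp: represents_def\<close>)

lemma exec_Read:
  assumes "represents X xs s"
  shows "exec (Read i) (l, X, xs) = (Suc l, X(i := int (s 30 0)), tl xs)"
proof -
  have "(if 0 < length xs then xs ! 0 else 0) = int (s 30 0)"
    using assms unfolding represents_def by blast
  then show ?thesis by (cases xs) auto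
qed

lemma doubling:
  assumes "code_at P l (replicate k (Add a a a))"
  shows "reach P k (l, X, xs) (l + k, X(a := 2 ^ k * X a), xs)"
  using assms
proof (induction k arbitrary: l X)
  case (Suc k)
  let ?Y = "X(a := X a + X a)"
  have "reach P k (Suc l, ?Y, xs) (Suc l + k, ?Y(a := 2 ^ k * ?Y a), xs)"
    using Suc by (intro Suc.IH) simp
  moreover have "?Y(a := 2 ^ k * ?Y a) = X(a := 2 ^ Suc k * X a)" by auto
  moreover have "exec (P ! l) (l, X, xs) = (Suc l, ?Y, xs)" using Suc.prems by simp
  ultimately have "reach P k (exec (P ! l) (l, X, xs)) (l + Suc k, X(a := 2 ^ Suc k * X a), xs)" by simp
  then show ?case by (rule reach_step[rotated]) (use Suc.prems in simp)
qed (simp add: reach_refl)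

lemma code_at_compile_addr: "code_at P l (compile_addr r e t) \<Longrightarrow> code_at P l (compile_exp e t)"
  by (simp add: compile_addr.simps)

lemma compile_addr_correct:
  assumes code: "code_at P l (compile_addr r e t)"
    and e: "reach P (length (compile_exp e t)) (l, X, xs) (l + length (compile_exp e t), X', xs)"
      "X' (tmp t) = int v" "\<And>a. (\<forall>t'\<ge>t. a \<noteq> tmp t') \<Longrightarrow> X' a = X a"
  shows "\<exists>X'. reach P (length (compile_addr r e t)) (l, X, xs) (l + length (compile_addr r e t), X', xs) \<and>
     X' (tmp t) = int (addr r v) \<and> (\<forall>a. (\<forall>t'\<ge>t. a \<noteq> tmp t') \<longrightarrow> X' a = X a)"
proof -
  let ?l = "l + length (compile_exp e t)"
  let ?X1 = "X'(tmp t := 2 ^ 5 * X' (tmp t))"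
  let ?X2 = "?X1(tmp (Suc t) := int r, tmp t := ?X1 (tmp t) + int r)"
  from code have c: "code_at P ?l (replicate 5 (Add (tmp t) (tmp t) (tmp t)))"
    "code_at P (?l + 5) [Const (tmp (Suc t)) (int r), Add (tmp t) (tmp t) (tmp (Suc t))]"
    by (simp_all add: compile_addr.simps ac_simps)
  have "reach P 5 (?l, X', xs) (?l + 5, ?X1, xs)" using c(1) by (rule doubling)
  moreover have "reach P (Suc (Suc 0)) (?l + 5, ?X1, xs) (?l + 7, ?X2, xs)"
    using c(2) by (auto intro!: reach_intros)
  ultimately have "reach P (length (compile_exp e t) + (5 + Suc (Suc 0))) (l, X, xs) (?l + 7, ?X2, xs)"
    using reach_trans e(1) by blast
  moreover have "?X2 (tmp t) = int (addr r v)" using e(2) by (simp add: addr_def)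
  moreover have "?X2 a = X a" if "\<forall>t'\<ge>t. a \<noteq> tmp t'" for a
    using e(3)[OF that] that[rule_format, of t] that[rule_format, of "Suc t"] by simp
  moreover have "length (compile_addr r e t) = length (compile_exp e t) + (5 + Suc (Suc 0))"
    "l + length (compile_addr r e t) = ?l + 7"
    by (simp_all add: compile_addr.simps)
  ultimately show ?thesis by metis
qed

lemma compile_exp_correct:
  assumes "represents X xs s" "wf_exp e" "code_at P l (compile_exp e t)"
  shows "\<exists>X'. reach P (length (compile_exp e t)) (l, X, xs) (l + length (compile_exp e t), X', xs) \<and>
     X' (tmp t) = int (eval e s) \<and> (\<forall>a. (\<forall>t'\<ge>t. a \<noteq> tmp t') \<longrightarrow> X' a = X a)"
  using assms
proof (induction e arbitrary: l X t)
  case (Lit c)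
  then have "reach P (Suc 0) (l, X, xs) (Suc l, X(tmp t := int c), xs)"
    by (auto intro!: reach_intros)
  moreover have "l + length (compile_exp (Lit c) t) = Suc l" "length (compile_exp (Lit c) t) = Suc 0" by simp_all
  moreover have "\<forall>a. (\<forall>t'\<ge>t. a \<noteq> tmp t') \<longrightarrow> (X(tmp t := int c)) a = X a" by simp
  moreover have "(X(tmp t := int c)) (tmp t) = int (eval (Lit c) s)" by simp
  ultimately show ?case by metis
next
  case (Cell r e)
  then have code: "code_at P l (compile_addr r e t)" and wf: "wf_exp e" and r: "r < 30"
    and load: "code_at P (l + length (compile_addr r e t)) [Load (tmp t) (tmp t)]"
    by (simp_all add: ac_simps)
  obtain X1 where "reach P (length (compile_exp e t)) (l, X, xs) (l + length (compile_exp e t), X1, xs)"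
     "X1 (tmp t) = int (eval e s)" "\<And>a. (\<forall>t'\<ge>t. a \<noteq> tmp t') \<Longrightarrow> X1 a = X a"
    using Cell.IH[OF Cell.prems(1) wf code_at_compile_addr[OF code]] by blast
  from compile_addr_correct[OF code this] obtain X2 where
    X2: "reach P (length (compile_addr r e t)) (l, X, xs) (l + length (compile_addr r e t), X2, xs)"
    "X2 (tmp t) = int (addr r (eval e s))" "\<And>a. (\<forall>t'\<ge>t. a \<noteq> tmp t') \<Longrightarrow> X2 a = X a"
    by blast
  let ?X3 = "X2(tmp t := X2 (addr r (eval e s)))"
  have "nat (X2 (tmp t)) = addr r (eval e s)" using X2(2) by (metis nat_int)
  then have "reach P (Suc 0) (l + length (compile_addr r e t), X2, xs) (Suc (l + length (compile_addr r e t)), ?X3, xs)"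
    using load by (auto intro!: reach_intros)
  from reach_trans[OF X2(1) this]
  have "reach P (length (compile_exp (Cell r e) t)) (l, X, xs) (l + length (compile_exp (Cell r e) t), ?X3, xs)"
    by simp
  moreover have "X2 (addr r (eval e s)) = int (s r (eval e s))"
  proof -
    have "X2 (addr r (eval e s)) = X (addr r (eval e s))"
      by (intro X2(3) allI impI addr_neq_tmp) (use r in simp)
    then show ?thesis using represents_cell[OF Cell.prems(1) r] by simp
  qed
  moreover have "?X3 a = X a" if "\<forall>t'\<ge>t. a \<noteq> tmp t'" for a
    using X2(3)[OF that] that by simp
  moreover have "?X3 (tmp t) = X2 (addr r (eval e s))" by simp
  ultimately show ?case by (metis eval.simps(2))
next
  case (Plus e f)
  let ?l = "l + length (compile_exp e t)"
  let ?m = "?l + length (compile_exp f (Suc t))"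
  from Plus.prems have code: "code_at P l (compile_exp e t)" "code_at P ?l (compile_exp f (Suc t))"
    "code_at P ?m [Add (tmp t) (tmp t) (tmp (Suc t))]" and wf: "wf_exp e" "wf_exp f"
    by (simp_all add: ac_simps)
  obtain X1 where X1: "reach P (length (compile_exp e t)) (l, X, xs) (?l, X1, xs)"
     "X1 (tmp t) = int (eval e s)" "\<And>a. (\<forall>t'\<ge>t. a \<noteq> tmp t') \<Longrightarrow> X1 a = X a"
    using Plus.IH(1)[OF Plus.prems(1) wf(1) code(1)] by blast
  have "represents X1 xs s" using Plus.prems(1) by (rule represents_tmp) (use X1(3) in auto)
  then obtain X2 where X2: "reach P (length (compile_exp f (Suc t))) (?l, X1, xs) (?m, X2, xs)"
     "X2 (tmp (Suc t)) = int (eval f s)" "\<And>a. (\<forall>t'\<ge>Suc t. a \<noteq> tmp t') \<Longrightarrow> X2 a = X1 a"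
    using Plus.IH(2)[OF _ wf(2) code(2)] by blast
  let ?X3 = "X2(tmp t := X2 (tmp t) + X2 (tmp (Suc t)))"
  have "reach P (Suc 0) (?m, X2, xs) (Suc ?m, ?X3, xs)"
    using code(3) by (auto intro!: reach_intros)
  from reach_trans[OF X1(1) reach_trans[OF X2(1) this]]
  have "reach P (length (compile_exp (Plus e f) t)) (l, X, xs) (l + length (compile_exp (Plus e f) t), ?X3, xs)"
    by (simp add: ac_simps)
  moreover have "X2 (tmp t) = X1 (tmp t)" by (rule X2(3)) auto
  moreover have "?X3 a = X a" if a: "\<forall>t'\<ge>t. a \<noteq> tmp t'" for a
  proof -
    have "X2 a = X1 a" using a by (intro X2(3)) auto
    then show ?thesis using X1(3)[OF a] a by auto
  qed
  moreover have "?X3 (tmp t) = X2 (tmp t) + X2 (tmp (Suc t))" by simp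
  ultimately show ?case using X1(2) X2(2) by (metis eval.simps(3) of_nat_add)
qed

definition simulates :: "instr list \<Rightarrow> nat \<Rightarrow> nat \<Rightarrow> state \<Rightarrow> nat \<Rightarrow> state \<Rightarrow> bool" where
  "simulates P T l s l' s' \<longleftrightarrow> (\<forall>X xs. represents X xs s \<longrightarrow>
     (\<exists>X' xs'. reach P T (l, X, xs) (l', X', xs') \<and> represents X' xs' s'))"

lemma simulates_trans:
  "simulates P T l s l' s' \<Longrightarrow> simulates P T' l' s' l'' s'' \<Longrightarrow> simulates P (T + T') l s l'' s''"
  unfolding simulates_def using reach_trans by meson

lemma simulates_mono: "simulates P T l s l' s' \<Longrightarrow> T \<le> T' \<Longrightarrow> simulates P T' l s l' s'"
  unfolding simulates_def using reach_mono by meson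

lemma compile_correct:
  assumes "wf_com c" "code_at P l (compile c l)"
  shows "simulates P (poly (time c) (s 0 0)) l s (l + code_len c) (sem c s)"
  using assms
proof (induction c arbitrary: l s)
  case Skip
  then show ?case by (auto simp: simulates_def intro: reach_refl)
next
  case (Assign r e f)
  let ?l = "l + length (compile_addr r e 0)"
  let ?m = "?l + length (compile_exp f 1)"
  from Assign.prems have code: "code_at P l (compile_addr r e 0)"
    "code_at P ?l (compile_exp f 1)" "code_at P ?m [Store (tmp 0) (tmp 1)]"
    and wf: "r < 30" "wf_exp e" "wf_exp f"
    by (simp_all add: ac_simps)
  show ?case unfolding simulates_def
  proof (intro allI impI)
    fix X xs assume rep: "represents X xs s"
    obtain X0 where "reach P (length (compile_exp e 0)) (l, X, xs) (l + length (compile_exp e 0), X0, xs)"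
      "X0 (tmp 0) = int (eval e s)" "\<And>a. (\<forall>t'\<ge>0. a \<noteq> tmp t') \<Longrightarrow> X0 a = X a"
      using compile_exp_correct[OF rep wf(2) code_at_compile_addr[OF code(1)]] by blast
    from compile_addr_correct[OF code(1) this] obtain X1 where
      X1: "reach P (length (compile_addr r e 0)) (l, X, xs) (?l, X1, xs)"
      "X1 (tmp 0) = int (addr r (eval e s))" "\<And>a. (\<forall>t'\<ge>0. a \<noteq> tmp t') \<Longrightarrow> X1 a = X a"
      by blast
    have rep1: "represents X1 xs s" using rep by (rule represents_tmp) (use X1(3) in auto)
    then obtain X2 where X2: "reach P (length (compile_exp f 1)) (?l, X1, xs) (?m, X2, xs)"
      "X2 (tmp 1) = int (eval f s)" "\<And>a. (\<forall>t'\<ge>1. a \<noteq> tmp t') \<Longrightarrow> X2 a = X1 a"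
      using compile_exp_correct[OF _ wf(3) code(2)] by blast
    have rep2: "represents X2 xs s" using rep1 by (rule represents_tmp) (use X2(3) in auto)
    have "X2 (tmp 0) = X1 (tmp 0)" by (rule X2(3)) auto
    then have "nat (X2 (tmp 0)) = addr r (eval e s)" using X1(2) by (metis nat_int)
    then have "reach P (Suc 0) (?m, X2, xs) (Suc ?m, X2(addr r (eval e s) := int (eval f s)), xs)"
      using code(3) X2(2) by (auto intro!: reach_intros)
    from reach_trans[OF X1(1) reach_trans[OF X2(1) this]]
    have "reach P (poly (time (Assign r e f)) (s 0 0)) (l, X, xs)
      (l + code_len (Assign r e f), X2(addr r (eval e s) := int (eval f s)), xs)"
      by (simp add: ac_simps)
    moreover have "represents (X2(addr r (eval e s) := int (eval f s))) xs (sem (Assign r e f) s)"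
      using represents_upd[OF rep2 wf(1)] by simp
    ultimately show "\<exists>X' xs'. reach P (poly (time (Assign r e f)) (s 0 0)) (l, X, xs)
      (l + code_len (Assign r e f), X', xs') \<and> represents X' xs' (sem (Assign r e f) s)" by blast
  qed
next
  case (Input r e)
  let ?l = "l + length (compile_addr r e 0)"
  from Input.prems have code: "code_at P l (compile_addr r e 0)"
    "code_at P ?l [Read (tmp 1), Store (tmp 0) (tmp 1)]"
    and wf: "r < 30" "wf_exp e"
    by (simp_all add: ac_simps)
  show ?case unfolding simulates_def
  proof (intro allI impI)
    fix X xs assume rep: "represents X xs s"
    obtain X0 where "reach P (length (compile_exp e 0)) (l, X, xs) (l + length (compile_exp e 0), X0, xs)"
      "X0 (tmp 0) = int (eval e s)" "\<And>a. (\<forall>t'\<ge>0. a \<noteq> tmp t') \<Longrightarrow> X0 a = X a"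
      using compile_exp_correct[OF rep wf(2) code_at_compile_addr[OF code(1)]] by blast
    from compile_addr_correct[OF code(1) this] obtain X1 where
      X1: "reach P (length (compile_addr r e 0)) (l, X, xs) (?l, X1, xs)"
      "X1 (tmp 0) = int (addr r (eval e s))" "\<And>a. (\<forall>t'\<ge>0. a \<noteq> tmp t') \<Longrightarrow> X1 a = X a"
      by blast
    have rep1: "represents X1 xs s" using rep by (rule represents_tmp) (use X1(3) in auto)
    let ?X2 = "X1(tmp 1 := int (s 30 0))"
    have rep2: "represents ?X2 xs s" using rep1 by (rule represents_upd_tmp)
    have "?X2 (tmp 0) = int (addr r (eval e s))" using X1(2) by simp
    then have "nat (?X2 (tmp 0)) = addr r (eval e s)" by (metis nat_int)
    then have "reach P (Suc (Suc 0)) (?l, X1, xs) (Suc (Suc ?l), ?X2(addr r (eval e s) := int (s 30 0)), tl xs)"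
      using code(2) exec_Read[OF rep1, of "tmp 1" ?l]
      by (auto intro!: reach_intros)
    from reach_trans[OF X1(1) this]
    have "reach P (poly (time (Input r e)) (s 0 0)) (l, X, xs)
      (l + code_len (Input r e), ?X2(addr r (eval e s) := int (s 30 0)), tl xs)"
      by (simp add: ac_simps)
    moreover have "represents (?X2(addr r (eval e s) := int (s 30 0))) (tl xs) (sem (Input r e) s)"
      using represents_pop[OF represents_upd[OF rep2 wf(1), of "eval e s" "s 30 0"]] wf(1)
      by (simp add: upd_def)
    ultimately show "\<exists>X' xs'. reach P (poly (time (Input r e)) (s 0 0)) (l, X, xs)
      (l + code_len (Input r e), X', xs') \<and> represents X' xs' (sem (Input r e) s)" by blast
  qed
next
  case (Seq c d)
  then have "simulates P (poly (time c) (s 0 0)) l s (l + code_len c) (sem c s)"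
    "simulates P (poly (time d) (sem c s 0 0)) (l + code_len c) (sem c s) (l + code_len c + code_len d) (sem d (sem c s))"
    by (simp_all add: length_compile)
  moreover have "sem c s 0 = s 0" using Seq.prems by (simp add: sem_size)
  ultimately show ?case using simulates_trans by (fastforce simp: add.assoc)
next
  case (Cond a b c d)
  let ?l = "l + length (compile_exp a 0)"
  let ?m = "?l + length (compile_exp b 1)"
  let ?C = "?m + 4 + code_len d"
  let ?T = "length (compile_exp a 0) + length (compile_exp b 1) + 2"
  from Cond.prems have code: "code_at P l (compile_exp a 0)" "code_at P ?l (compile_exp b 1)"
    "code_at P ?m [Sub (tmp 0) (tmp 1) (tmp 0), JumpPos (tmp 0) ?C]"
    "code_at P (?m + 2) (compile d (?m + 2))"
    "code_at P (?m + 2 + code_len d) [Const (tmp 0) 1, JumpPos (tmp 0) (?C + code_len c)]"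
    "code_at P ?C (compile c ?C)"
    and wf: "wf_exp a" "wf_exp b" "wf_com c" "wf_com d"
    by (simp_all add: Let_def length_compile ac_simps eval_nat_numeral)
  have test: "simulates P ?T l s (if eval a s < eval b s then ?C else ?m + 2) s"
    unfolding simulates_def
  proof (intro allI impI)
    fix X xs assume rep: "represents X xs s"
    obtain X1 where X1: "reach P (length (compile_exp a 0)) (l, X, xs) (?l, X1, xs)"
      "X1 (tmp 0) = int (eval a s)" "\<And>i. (\<forall>t'\<ge>0. i \<noteq> tmp t') \<Longrightarrow> X1 i = X i"
      using compile_exp_correct[OF rep wf(1) code(1)] by blast
    have rep1: "represents X1 xs s" using rep by (rule represents_tmp) (use X1(3) in auto)
    then obtain X2 where X2: "reach P (length (compile_exp b 1)) (?l, X1, xs) (?m, X2, xs)"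
      "X2 (tmp 1) = int (eval b s)" "\<And>i. (\<forall>t'\<ge>1. i \<noteq> tmp t') \<Longrightarrow> X2 i = X1 i"
      using compile_exp_correct[OF _ wf(2) code(2)] by blast
    have rep2: "represents X2 xs s" using rep1 by (rule represents_tmp) (use X2(3) in auto)
    have "X2 (tmp 0) = X1 (tmp 0)" by (rule X2(3)) auto
    then have "X2 (tmp 1) - X2 (tmp 0) > 0 \<longleftrightarrow> eval a s < eval b s" using X1 X2 by simp
    then have "reach P (Suc (Suc 0)) (?m, X2, xs)
      (if eval a s < eval b s then ?C else ?m + 2, X2(tmp 0 := X2 (tmp 1) - X2 (tmp 0)), xs)"
      using code(3) by (auto intro!: reach_intros)
    from reach_trans[OF X1(1) reach_trans[OF X2(1) this]]
    have "reach P ?T (l, X, xs) (if eval a s < eval b s then ?C else ?m + 2,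
        X2(tmp 0 := X2 (tmp 1) - X2 (tmp 0)), xs)"
      by (simp add: ac_simps)
    then show "\<exists>X' xs'. reach P ?T (l, X, xs) (if eval a s < eval b s then ?C else ?m + 2, X', xs') \<and>
      represents X' xs' s"
      using represents_upd_tmp[OF rep2] by blast
  qed
  show ?case
  proof (cases "eval a s < eval b s")
    case True
    have "simulates P (poly (time c) (s 0 0)) ?C s (?C + code_len c) (sem c s)"
      using Cond.IH(1) code wf by blast
    moreover have "simulates P ?T l s ?C s" using True test by simp
    ultimately have "simulates P (?T + poly (time c) (s 0 0)) l s (?C + code_len c) (sem c s)"
      using simulates_trans by blast
    then show ?thesis using True
      by (auto elim!: simulates_mono simp: add.assoc add.commute add.left_commute)
  next
    case False
    have "simulates P (poly (time d) (s 0 0)) (?m + 2) s (?m + 2 + code_len d) (sem d s)"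
      using Cond.IH(2) code wf by blast
    moreover have "simulates P (Suc (Suc 0)) (?m + 2 + code_len d) (sem d s) (?C + code_len c) (sem d s)"
      unfolding simulates_def
    proof (intro allI impI)
      fix X xs assume rep: "represents X xs (sem d s)"
      have "reach P (Suc (Suc 0)) (?m + 2 + code_len d, X, xs) (?C + code_len c, X(tmp 0 := 1), xs)"
        using code(5) by (auto intro!: reach_intros)
      then show "\<exists>X' xs'. reach P (Suc (Suc 0)) (?m + 2 + code_len d, X, xs) (?C + code_len c, X', xs') \<and>
          represents X' xs' (sem d s)" using represents_upd_tmp[OF rep] by blast
    qed
    moreover have "simulates P ?T l s (?m + 2) s" using False test by simp
    ultimately have "simulates P (?T + (poly (time d) (s 0 0) + Suc (Suc 0))) l s (?C + code_len c) (sem d s)"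
      using simulates_trans by blast
    then show ?thesis using False
      by (auto elim!: simulates_mono simp: add.assoc add.commute add.left_commute)
  qed
next
  case (For r c)
  define n where "n = s 0 0"
  define B where "B = poly (time c) n"
  let ?m = "l + 5 + code_len c"
  define S where "S k = upd (fold (\<lambda>k s. sem c (upd s r 0 k)) [0..<k] s) r 0 k" for k
  from For.prems have wf: "0 < r" "r < 30" "r \<notin> writes c" "wf_com c"
    and code: "code_at P l [Const (addr r 0) 0, Sub (tmp 0) (addr 0 0) (addr r 0), JumpPos (tmp 0) (l + 5),
      Const (tmp 0) 1, JumpPos (tmp 0) (l + 8 + code_len c)]"
    "code_at P (l + 5) (compile c (l + 5))"
    "code_at P ?m [Const (tmp 0) 1, Add (addr r 0) (addr r 0) (tmp 0), JumpPos (tmp 0) (l + 1)]"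
    by (simp_all add: length_compile ac_simps eval_nat_numeral)
  have S_Suc: "S (Suc k) = upd (sem c (S k)) r 0 (Suc k)" for k
    unfolding S_def by (simp add: upd_def)
  have S_n: "S k 0 = s 0" for k
  proof (induction k)
    case 0 then show ?case using wf unfolding S_def upd_def by simp
  next
    case (Suc k) then show ?case unfolding S_Suc using wf by (simp add: upd_def sem_size)
  qed
  have S_r: "sem c (S k) r 0 = k" "S k r 0 = k" for k
    using sem_not_writes[OF wf(3)] by (simp_all add: S_def upd_def)
  have r_tmp: "addr r 0 \<noteq> tmp 0" "addr 0 0 \<noteq> tmp 0" using wf(2) addr_neq_tmp by simp_all
  have start: "simulates P 1 l s (l + 1) (S 0)"
    unfolding simulates_def
  proof (intro allI impI)
    fix X xs assume rep: "represents X xs s"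
    have "reach P (Suc 0) (l, X, xs) (l + 1, X(addr r 0 := int 0), xs)"
      using code(1) by (auto intro!: reach_intros)
    then show "\<exists>X' xs'. reach P 1 (l, X, xs) (l + 1, X', xs') \<and> represents X' xs' (S 0)"
      using represents_upd[OF rep wf(2), of 0 0] by (auto simp: S_def)
  qed
  have test: "simulates P (Suc (Suc 0)) (l + 1) (S k) (if k < n then l + 5 else l + 3) (S k)" for k
    unfolding simulates_def
  proof (intro allI impI)
    fix X xs assume rep: "represents X xs (S k)"
    have "X (addr 0 0) - X (addr r 0) = int n - int k"
      using represents_cell[OF rep, of 0 0] represents_cell[OF rep wf(2), of 0] S_n S_r
      by (simp add: n_def)
    then have "reach P (Suc (Suc 0)) (l + 1, X, xs) (if k < n then l + 5 else l + 3, X(tmp 0 := int n - int k), xs)"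
      using code(1) by (auto intro!: reach_intros)
    then show "\<exists>X' xs'. reach P (Suc (Suc 0)) (l + 1, X, xs) (if k < n then l + 5 else l + 3, X', xs') \<and> represents X' xs' (S k)"
      using represents_upd_tmp[OF rep] by blast
  qed
  have repeat: "simulates P (Suc (Suc (Suc 0))) ?m (sem c (S k)) (l + 1) (S (Suc k))" for k
    unfolding simulates_def
  proof (intro allI impI)
    fix X xs assume rep: "represents X xs (sem c (S k))"
    let ?X = "X(tmp 0 := 1, addr r 0 := int (Suc k))"
    have "X (addr r 0) = int k" using represents_cell[OF rep wf(2), of 0] S_r by simp
    then have "reach P (Suc (Suc (Suc 0))) (?m, X, xs) (l + 1, ?X, xs)"
      using code(3) r_tmp by (auto intro!: reach_intros simp: add.commute)
    moreover have "represents ?X xs (S (Suc k))" unfolding S_Suc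
      using represents_upd[OF represents_upd_tmp[OF rep] wf(2)] .
    ultimately show "\<exists>X' xs'. reach P (Suc (Suc (Suc 0))) (?m, X, xs) (l + 1, X', xs') \<and> represents X' xs' (S (Suc k))"
      by blast
  qed
  have loop: "simulates P (1 + k * (5 + B)) l s (l + 1) (S k)" if "k \<le> n" for k
    using that
  proof (induction k)
    case 0 then show ?case using start by simp
  next
    case (Suc k)
    have body: "simulates P B (l + 5) (S k) ?m (sem c (S k))"
      using For.IH[OF wf(4) code(2), of "S k"] S_n unfolding B_def n_def by simp
    have enter: "simulates P (Suc (Suc 0)) (l + 1) (S k) (l + 5) (S k)" using test[of k] Suc.prems by simp
    have "simulates P (1 + k * (5 + B) + (Suc (Suc 0) + (B + Suc (Suc (Suc 0))))) l s (l + 1) (S (Suc k))"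
      using Suc by (intro simulates_trans[OF _ simulates_trans[OF enter simulates_trans[OF body repeat]]]) simp
    then show ?case by (rule simulates_mono) simp
  qed
  have exit: "simulates P (Suc (Suc 0)) (l + 3) (S n) (l + 8 + code_len c) (S n)"
    unfolding simulates_def
  proof (intro allI impI)
    fix X xs assume rep: "represents X xs (S n)"
    have "reach P (Suc (Suc 0)) (l + 3, X, xs) (l + 8 + code_len c, X(tmp 0 := 1), xs)"
      using code(1) by (auto intro!: reach_intros simp: numeral_3_eq_3)
    then show "\<exists>X' xs'. reach P (Suc (Suc 0)) (l + 3, X, xs) (l + 8 + code_len c, X', xs') \<and> represents X' xs' (S n)"
      using represents_upd_tmp[OF rep] by blast
  qed
  have "simulates P (1 + n * (5 + B) + (Suc (Suc 0) + Suc (Suc 0))) l s (l + 8 + code_len c) (S n)"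
  proof (rule simulates_trans[OF loop simulates_trans[OF _ exit]])
    show "simulates P (Suc (Suc 0)) (l + 1) (S n) (l + 3) (S n)" using test[of n] by simp
  qed simp
  moreover have "S n = sem (For r c) s" unfolding S_def n_def by simp
  moreover have "1 + n * (5 + B) + (Suc (Suc 0) + Suc (Suc 0)) = poly (time (For r c)) (s 0 0)"
    by (simp add: B_def n_def algebra_simps)
  moreover have "l + code_len (For r c) = l + 8 + code_len c" by simp
  ultimately show ?case by (simp only:)
qed

text \<open>Array 0 holds the size, array 1 the parameter and array 2 the answer.\<close>

definition initial :: "nat \<Rightarrow> nat \<Rightarrow> nat list \<Rightarrow> state" where
  "initial n k ys = (\<lambda>r x. if r = 0 \<and> x = 0 then n else if r = 1 \<and> x = 0 then k
     else if r = 30 \<and> x < length ys then ys ! x else 0)"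

lemma poly_nat_mono: "x \<le> y \<Longrightarrow> poly p x \<le> poly p y" for p :: "nat poly"
  by (induction p) (auto intro: add_mono mult_mono)

lemma funpow_fixed: "f x = x \<Longrightarrow> (f ^^ n) x = x"
  by (induction n) auto

lemma polytime_decidableI:
  assumes wf: "wf_com c"
    and enc: "\<And>x. x \<in> I \<Longrightarrow> enc x = int (sz x) # arg x # map int (tape x)"
    and bound: "\<And>x. x \<in> I \<Longrightarrow> sz x \<le> input_size (enc x)"
    and sem: "\<And>x. x \<in> I \<Longrightarrow> Q x \<longleftrightarrow> 0 < sem c (initial (sz x) (nat (arg x)) (tape x)) 2 0"
  shows "polytime_decidable enc I Q"
proof -
  let ?m = "4 + code_len c"
  define P where "P = [Read (addr 0 0), Read (addr 1 0), JumpPos (addr 1 0) 4, Const (addr 1 0) 0] @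
    compile c 4 @ [JumpPos (addr 2 0) (?m + 2), Halt False, Halt True]"
  have len: "length P = ?m + 3" unfolding P_def by (simp add: length_compile)
  have code: "code_at P 4 (compile c 4)"
    using code_at_middle[of "[Read (addr 0 0), Read (addr 1 0), JumpPos (addr 1 0) 4, Const (addr 1 0) 0]"
      "compile c 4"] unfolding P_def by (simp add: eval_nat_numeral)
  have code_end: "code_at P ?m [JumpPos (addr 2 0) (?m + 2), Halt False, Halt True]"
    using code_at_middle[of "[Read (addr 0 0), Read (addr 1 0), JumpPos (addr 1 0) 4, Const (addr 1 0) 0] @
      compile c 4" "[JumpPos (addr 2 0) (?m + 2), Halt False, Halt True]" "[]"]
    unfolding P_def append_Nil2 append_assoc by (simp only: length_append length_compile) simp
  have code_start: "code_at P 0 [Read (addr 0 0), Read (addr 1 0), JumpPos (addr 1 0) 4, Const (addr 1 0) 0]"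
    unfolding P_def by simp
  have "answers_within P (enc x) (poly (time c + [:5:]) (input_size (enc x))) (Q x)" if x: "x \<in> I" for x
  proof -
    let ?s = "initial (sz x) (nat (arg x)) (tape x)"
    let ?T = "poly (time c + [:5:]) (input_size (enc x))"
    define X0 where "X0 = (\<lambda>_. 0 :: int)(addr 0 0 := int (sz x), addr 1 0 := int (nat (arg x)))"
    have "reach P (Suc (Suc (Suc (Suc 0)))) (0, \<lambda>_. 0, enc x) (4, X0, map int (tape x))"
    proof (cases "arg x > 0")
      case True
      then have X0: "X0 = (\<lambda>_. 0)(addr 0 0 := int (sz x), addr 1 0 := arg x)" unfolding X0_def by simp
      have "reach P (Suc (Suc (Suc 0))) (0, \<lambda>_. 0, enc x) (4, X0, map int (tape x))"
        unfolding X0 enc[OF x] using code_start True by (auto intro!: reach_intros)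
      then show ?thesis by (rule reach_mono) simp
    next
      case False
      then have X0: "X0 = ((\<lambda>_. 0)(addr 0 0 := int (sz x), addr 1 0 := arg x))(addr 1 0 := 0)"
        unfolding X0_def by simp
      show ?thesis unfolding X0 enc[OF x]
        using code_start False by (auto intro!: reach_intros)
    qed
    moreover have rep0: "represents X0 (map int (tape x)) ?s"
      unfolding represents_def X0_def initial_def by auto
    have "?s 0 0 = sz x" by (simp add: initial_def)
    then have "simulates P (poly (time c) (sz x)) 4 ?s ?m (sem c ?s)"
      using compile_correct[OF wf code, of ?s] by simp
    with rep0 obtain X xs where "reach P (poly (time c) (sz x)) (4, X0, map int (tape x)) (?m, X, xs)"
      and rep: "represents X xs (sem c ?s)"
      unfolding simulates_def by blast
    moreover have "reach P (Suc 0) (?m, X, xs) (if Q x then ?m + 2 else ?m + 1, X, xs)"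
    proof -
      have "X (addr 2 0) > 0 \<longleftrightarrow> Q x" using represents_cell[OF rep, of 2 0] sem[OF x] by simp
      then show ?thesis using code_end by (auto intro!: reach_intros)
    qed
    ultimately have "reach P (Suc (Suc (Suc (Suc 0))) + (poly (time c) (sz x) + Suc 0))
      (0, \<lambda>_. 0, enc x) (if Q x then ?m + 2 else ?m + 1, X, xs)"
      using reach_trans by meson
    moreover have "Suc (Suc (Suc (Suc 0))) + (poly (time c) (sz x) + Suc 0) \<le> ?T"
      using poly_nat_mono[OF bound[OF x], of "time c"] by simp
    ultimately have "reach P ?T (0, \<lambda>_. 0, enc x) (if Q x then ?m + 2 else ?m + 1, X, xs)"
      by (rule reach_mono)
    then obtain t where t: "t \<le> ?T" "(step P ^^ t) (0, \<lambda>_. 0, enc x) = (if Q x then ?m + 2 else ?m + 1, X, xs)"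
      unfolding reach_def by blast
    have halt: "P ! (if Q x then ?m + 2 else ?m + 1) = Halt (Q x)" using code_end by simp
    then have "step P (if Q x then ?m + 2 else ?m + 1, X, xs) = (if Q x then ?m + 2 else ?m + 1, X, xs)"
      unfolding step_def by simp
    then have "(step P ^^ (?T - t)) ((step P ^^ t) (0, \<lambda>_. 0, enc x)) = (if Q x then ?m + 2 else ?m + 1, X, xs)"
      unfolding t(2) by (rule funpow_fixed)
    then have "(step P ^^ (?T - t + t)) (0, \<lambda>_. 0, enc x) = (if Q x then ?m + 2 else ?m + 1, X, xs)"
      unfolding funpow_add comp_apply .
    then have "(step P ^^ ?T) (0, \<lambda>_. 0, enc x) = (if Q x then ?m + 2 else ?m + 1, X, xs)"
      using t(1) by (simp only: le_add_diff_inverse2)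
    then show ?thesis unfolding answers_within_def Let_def using halt len by auto
  qed
  then show ?thesis unfolding polytime_decidable_def by blast
qed

section \<open>The program\<close>

declare sem.simps(6) [simp del]

abbreviation var :: "nat \<Rightarrow> exp" where "var r \<equiv> Cell r (Lit 0)"
abbreviation adj :: "nat \<Rightarrow> nat \<Rightarrow> exp" where "adj r q \<equiv> Cell 3 (Plus (Cell 4 (var r)) (var q))"

text \<open>
  Arrays of the program: 0 the number of vertices, 1 the bound \<open>k\<close>, 2 the answer,
  3 the reflexive adjacency matrix, 4 its row offsets (there is no multiplication),
  5 and 6 the characteristic functions of the nonsimplicial vertices and of the current clique,
  7, 8, 9 and 10 the auction (see \<open>auction_state\<close>), 11 and 12 the price and the node of the best offer,
  13 to 17 loop counters.
\<close>

definition read_graph :: com where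
  "read_graph = For 13
     (Assign 4 (Plus (var 13) (Lit 1)) (Plus (Cell 4 (var 13)) (var 0)) ;;
      For 14 (Input 3 (Plus (Cell 4 (var 13)) (var 14))) ;;
      Assign 3 (Plus (Cell 4 (var 13)) (var 13)) (Lit 1))"

definition mark_nonsimplicial :: com where
  "mark_nonsimplicial = For 13 (For 14 (For 15
     (Cond (Lit 1) (Plus (adj 13 14) (adj 13 15))
        (Cond (adj 14 15) (Lit 1) (Assign 5 (var 13) (Lit 1)) Skip)
        Skip)))"

definition mark_core :: com where
  "mark_core = For 14
     (Assign 8 (var 14) (Lit 0) ;;
      Assign 9 (var 14) (Lit 0) ;;
      Cond (Cell 5 (var 13)) (Lit 1) (Assign 6 (var 14) (adj 13 14)) (Assign 6 (var 14) (Cell 5 (var 14))) ;;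
      Assign 10 (Lit 0) (Plus (var 10) (Cell 6 (var 14))))"

definition mark_satellites :: com where
  "mark_satellites = For 14
     (Assign 7 (Plus (var 14) (Lit 1)) (Lit 0) ;;
      Cond (Plus (Cell 6 (var 14)) (Cell 5 (var 14))) (Lit 1)
       (Assign 7 (Plus (var 14) (Lit 1)) (Lit 1) ;;
        For 15 (Cond (Plus (Lit 1) (Cell 6 (var 15))) (Plus (adj 14 15) (Cell 5 (var 15)))
          (Assign 7 (Plus (var 14) (Lit 1)) (Lit 0)) Skip))
       Skip)"

definition find_cheapest :: com where
  "find_cheapest = For 17 (Cond (Lit 1) (Plus (adj 16 17) (Cell 6 (var 17)))
     (Cond (Cell 8 (var 17)) (var 11)
        (Assign 11 (Lit 0) (Cell 8 (var 17)) ;; Assign 12 (Lit 0) (var 17)) Skip)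
     Skip)"

definition bid :: com where
  "bid = Cond (Lit 0) (Cell 7 (Plus (var 16) (Lit 1)))
     (Assign 11 (Lit 0) (var 0) ;;
      find_cheapest ;;
      Assign 7 (Plus (var 16) (Lit 1)) (Lit 0) ;;
      Cond (var 11) (var 0)
        (Assign 7 (Cell 9 (var 12)) (Lit 1) ;;
         Assign 9 (var 12) (Plus (var 16) (Lit 1)) ;;
         Assign 8 (var 12) (Plus (Cell 8 (var 12)) (Lit 1)))
        (Assign 10 (Lit 0) (Plus (var 10) (Lit 1))))
     Skip"

definition run_auction :: com where
  "run_auction = For 14 (For 15 (For 16 bid))"

definition rank_program :: com where
  "rank_program = read_graph ;; mark_nonsimplicial ;; For 13
     (Assign 10 (Lit 0) (Lit 0) ;;
      mark_core ;;
      mark_satellites ;;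
      run_auction ;;
      Cond (var 10) (var 1) Skip (Assign 2 (Lit 0) (Lit 1)))"

lemmas program_defs = read_graph_def mark_nonsimplicial_def mark_core_def mark_satellites_def
  find_cheapest_def bid_def run_auction_def

lemma wf_rank_program: "wf_com rank_program"
  unfolding rank_program_def program_defs by simp

lemma writes_program [simp]:
  "writes mark_core = {14, 8, 9, 6, 10}"
  "writes mark_satellites = {14, 7, 15}"
  "writes find_cheapest = {17, 11, 12}"
  "writes bid = {11, 17, 12, 7, 9, 8, 10}"
  "writes run_auction = {14, 15, 16, 11, 17, 12, 7, 9, 8, 10}"
  unfolding program_defs by auto

lemma upd_apply [simp]: "upd s r x v q = (if q = r then (s r)(x := v) else s q)"
  unfolding upd_def by simp

lemma sem_For_rule:
  assumes "I 0 s"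
    and "\<And>k t. k < s 0 0 \<Longrightarrow> I k t \<Longrightarrow> I (Suc k) (sem c (upd t r 0 k))"
    and "\<And>t. I (s 0 0) t \<Longrightarrow> I (s 0 0) (upd t r 0 (s 0 0))"
  shows "I (s 0 0) (sem (For r c) s)"
proof -
  have "I k (fold (\<lambda>k s. sem c (upd s r 0 k)) [0..<k] s)" if "k \<le> s 0 0" for k
    using that by (induction k) (use assms(1,2) in auto)
  then show ?thesis using assms(3) by (simp add: sem.simps(6))
qed

definition stores_graph :: "nat pair_pre_digraph \<Rightarrow> nat \<Rightarrow> nat \<Rightarrow> state \<Rightarrow> bool" where
  "stores_graph G n k s \<longleftrightarrow> s 0 0 = n \<and> s 1 0 = k \<and>
     (\<forall>u<n. \<forall>w<n. s 3 (s 4 u + w) = of_bool (w \<in> closed_nbhd G u))"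

definition stores_flags :: "nat pair_pre_digraph \<Rightarrow> nat \<Rightarrow> state \<Rightarrow> bool" where
  "stores_flags G n s \<longleftrightarrow> (\<forall>u<n. s 5 u = of_bool (u \<in> nonsimplicial G))"

lemma index_eq_iff: "w < n \<Longrightarrow> j < n \<Longrightarrow> u * n + w = k * n + j \<longleftrightarrow> u = k \<and> w = j" for n :: nat
  by (metis div_mult_self3 div_less add.right_neutral add_left_cancel gr_implies_not0)

lemma read_row:
  assumes s: "s 0 0 = n" "s 13 0 = i" "s 4 i = i * n"
  defines "s' \<equiv> sem (For 14 (Input 3 (Plus (Cell 4 (var 13)) (var 14)))) s"
  shows "\<And>w. w < n \<Longrightarrow> s' 3 (i * n + w) = s 30 w"
    and "\<And>u w. u \<noteq> i \<Longrightarrow> w < n \<Longrightarrow> s' 3 (u * n + w) = s 3 (u * n + w)"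
    and "\<And>x. s' 30 x = s 30 (n + x)"
proof -
  define I where "I j t \<longleftrightarrow> t 13 = s 13 \<and> t 4 = s 4 \<and> (\<forall>w<j. t 3 (i * n + w) = s 30 w) \<and>
    (\<forall>u w. u \<noteq> i \<longrightarrow> w < n \<longrightarrow> t 3 (u * n + w) = s 3 (u * n + w)) \<and> (\<forall>x. t 30 x = s 30 (j + x))" for j and t :: state
  have "I (s 0 0) s'" unfolding s'_def
  proof (rule sem_For_rule)
    show "I 0 s" unfolding I_def by simp
  next
    fix j t assume j: "j < s 0 0" and I: "I j t"
    then show "I (Suc j) (sem (Input 3 (Plus (Cell 4 (var 13)) (var 14))) (upd t 14 0 j))"
      using s index_eq_iff[of _ n j _ i] unfolding I_def by (auto simp: less_Suc_eq)
  qed (simp add: I_def)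
  then show "\<And>w. w < n \<Longrightarrow> s' 3 (i * n + w) = s 30 w"
    "\<And>u w. u \<noteq> i \<Longrightarrow> w < n \<Longrightarrow> s' 3 (u * n + w) = s 3 (u * n + w)"
    "\<And>x. s' 30 x = s 30 (n + x)"
    unfolding I_def s(1) by blast+
qed

lemma read_graph_correct:
  assumes s: "s 0 0 = n" "s 1 0 = k" "s 4 0 = 0"
    and matrix: "\<And>u w. u < n \<Longrightarrow> w < n \<Longrightarrow> u \<noteq> w \<Longrightarrow> s 30 (u * n + w) = of_bool (w \<in> closed_nbhd G u)"
  shows "stores_graph G n k (sem read_graph s)"
proof -
  define I where "I i t \<longleftrightarrow> t 0 = s 0 \<and> t 1 = s 1 \<and> (\<forall>u\<le>i. t 4 u = u * n) \<and>
    (\<forall>u<i. \<forall>w<n. t 3 (u * n + w) = of_bool (w \<in> closed_nbhd G u)) \<and> (\<forall>x. t 30 x = s 30 (i * n + x))" for i and t :: state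
  have "I (s 0 0) (sem read_graph s)" unfolding read_graph_def
  proof (rule sem_For_rule)
    show "I 0 s" unfolding I_def using s by simp
  next
    fix i t assume i: "i < s 0 0" and I: "I i t"
    let ?row = "For 14 (Input 3 (Plus (Cell 4 (var 13)) (var 14)))"
    define t1 where "t1 = sem (Assign 4 (Plus (var 13) (Lit 1)) (Plus (Cell 4 (var 13)) (var 0))) (upd t 13 0 i)"
    define t2 where "t2 = sem ?row t1"
    have t1: "t1 0 = s 0" "t1 1 = s 1" "t1 13 0 = i" "\<forall>u\<le>Suc i. t1 4 u = u * n" "t1 3 = t 3" "t1 30 = t 30"
      using I s unfolding I_def t1_def by (auto simp: le_Suc_eq)
    have "t2 q = t1 q" if "q \<notin> {3, 14, 30}" for q
      unfolding t2_def by (rule sem_not_writes) (use that in auto)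
    then have t2: "t2 0 = s 0" "t2 1 = s 1" "t2 13 0 = i" "\<forall>u\<le>Suc i. t2 4 u = u * n"
      using t1 by auto
    have t2': "\<And>w. w < n \<Longrightarrow> t2 3 (i * n + w) = s 30 (i * n + w)"
      "\<And>u w. u \<noteq> i \<Longrightarrow> w < n \<Longrightarrow> t2 3 (u * n + w) = t 3 (u * n + w)"
      "\<And>x. t2 30 x = s 30 (i * n + (n + x))"
      using read_row[of t1 n i] t1 s I unfolding t2_def[symmetric] I_def by auto
    have "sem (Assign 4 (Plus (var 13) (Lit 1)) (Plus (Cell 4 (var 13)) (var 0)) ;; ?row ;;
      Assign 3 (Plus (Cell 4 (var 13)) (var 13)) (Lit 1)) (upd t 13 0 i) = upd t2 3 (i * n + i) 1"
      using t2 unfolding t1_def t2_def by simp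
    moreover have "I (Suc i) (upd t2 3 (i * n + i) 1)"
      unfolding I_def
    proof (intro conjI allI impI)
      fix u w assume u: "u < Suc i" and w: "w < n"
      have in_self: "i \<in> closed_nbhd G i" unfolding closed_nbhd_def by simp
      have mat: "w \<noteq> i \<Longrightarrow> s 30 (i * n + w) = of_bool (w \<in> closed_nbhd G i)"
        using matrix[of i w] i s w by auto
      show "upd t2 3 (i * n + i) 1 3 (u * n + w) = of_bool (w \<in> closed_nbhd G u)"
      proof (cases "u = i")
        case True
        then show ?thesis using t2'(1)[OF w] mat in_self by auto
      next
        case False
        then have "t 3 (u * n + w) = of_bool (w \<in> closed_nbhd G u)" using I u w unfolding I_def by auto
        then show ?thesis using t2'(2)[OF False w] index_eq_iff[OF w, of i u i] False i s
          by simp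
      qed
    qed (use t2 t2' in \<open>auto simp: ac_simps\<close>)
    ultimately show "I (Suc i) (sem (Assign 4 (Plus (var 13) (Lit 1)) (Plus (Cell 4 (var 13)) (var 0)) ;; ?row ;;
      Assign 3 (Plus (Cell 4 (var 13)) (var 13)) (Lit 1)) (upd t 13 0 i))" by simp
  qed (simp add: I_def)
  then show ?thesis using s unfolding I_def stores_graph_def by simp
qed

lemma sem_not_writes_all: "(\<And>q. q \<in> Q \<Longrightarrow> q \<notin> writes c) \<Longrightarrow> \<forall>q\<in>Q. sem c s q = s q"
  using sem_not_writes by blast

lemma mark_nonsimplicial_correct:
  assumes G: "pair_graph G" and V: "pverts G = {0..<n}"
    and s: "stores_graph G n k s" and s5: "\<And>u. s 5 u = 0"
  shows "stores_graph G n k (sem mark_nonsimplicial s)" "stores_flags G n (sem mark_nonsimplicial s)"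
proof -
  define bad where "bad a b c \<longleftrightarrow> b \<in> closed_nbhd G a \<and> c \<in> closed_nbhd G a \<and> c \<notin> closed_nbhd G b" for a b c
  let ?body = "Cond (Lit 1) (Plus (adj 13 14) (adj 13 15))
        (Cond (adj 14 15) (Lit 1) (Assign 5 (var 13) (Lit 1)) Skip) Skip"
  have n: "s 0 0 = n" using s unfolding stores_graph_def by simp
  have inner: "sem (For 15 ?body) t 5 = (t 5)(a := if \<exists>c<n. bad a b c then 1 else t 5 a)"
    if t: "stores_graph G n k t" "t 13 0 = a" "t 14 0 = b" "a < n" "b < n" for t a b
  proof -
    define I where "I j t' \<longleftrightarrow> (\<forall>q. q \<notin> {5, 15} \<longrightarrow> t' q = t q) \<and>
      t' 5 = (t 5)(a := if \<exists>c<j. bad a b c then 1 else t 5 a)" for j and t' :: state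
    have tn: "t 0 0 = n" using t unfolding stores_graph_def by simp
    have "I (t 0 0) (sem (For 15 ?body) t)"
    proof (rule sem_For_rule)
      show "I 0 t" unfolding I_def by simp
    next
      fix j t' assume j: "j < t 0 0" and I: "I j t'"
      have M: "t 3 (t 4 a + b) = of_bool (b \<in> closed_nbhd G a)"
        "t 3 (t 4 a + j) = of_bool (j \<in> closed_nbhd G a)" "t 3 (t 4 b + j) = of_bool (j \<in> closed_nbhd G b)"
        using t j unfolding stores_graph_def by auto
      have sem: "sem ?body (upd t' 15 0 j) = (if bad a b j then upd (upd t' 15 0 j) 5 a 1 else upd t' 15 0 j)"
        using I t M unfolding I_def bad_def by simp
      show "I (Suc j) (sem ?body (upd t' 15 0 j))"
        unfolding sem using I unfolding I_def by (auto simp: less_Suc_eq fun_eq_iff)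
    qed (simp add: I_def)
    then show ?thesis unfolding I_def tn by blast
  qed
  have middle: "sem (For 14 (For 15 ?body)) t 5 = (t 5)(a := if \<exists>b<n. \<exists>c<n. bad a b c then 1 else t 5 a)"
    if t: "stores_graph G n k t" "t 13 0 = a" "a < n" for t a
  proof -
    define I where "I j t' \<longleftrightarrow> (\<forall>q. q \<notin> {5, 14, 15} \<longrightarrow> t' q = t q) \<and>
      t' 5 = (t 5)(a := if \<exists>b<j. \<exists>c<n. bad a b c then 1 else t 5 a)" for j and t' :: state
    have tn: "t 0 0 = n" using t unfolding stores_graph_def by simp
    have "I (t 0 0) (sem (For 14 (For 15 ?body)) t)"
    proof (rule sem_For_rule)
      show "I 0 t" unfolding I_def by simp
    next
      fix j t' assume j: "j < t 0 0" and I: "I j t'"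
      let ?t = "upd t' 14 0 j"
      have st: "stores_graph G n k ?t" "?t 13 0 = a" "?t 14 0 = j" "j < n"
        using t j tn I unfolding I_def stores_graph_def by auto
      then have "sem (For 15 ?body) ?t 5 = (t' 5)(a := if \<exists>c<n. bad a j c then 1 else t' 5 a)"
        using inner[of ?t a j] t(3) by auto
      moreover have "\<forall>q\<in>- {5, 15}. sem (For 15 ?body) ?t q = ?t q"
        by (rule sem_not_writes_all) auto
      ultimately show "I (Suc j) (sem (For 15 ?body) ?t)"
        using I unfolding I_def by (auto simp: less_Suc_eq fun_eq_iff)
    qed (simp add: I_def)
    then show ?thesis unfolding I_def tn by blast
  qed
  have outer: "(\<forall>q. q \<notin> {5, 13, 14, 15} \<longrightarrow> sem mark_nonsimplicial s q = s q) \<and>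
    (\<forall>a<n. sem mark_nonsimplicial s 5 a = of_bool (\<exists>b<n. \<exists>c<n. bad a b c))"
  proof -
    define I where "I j t' \<longleftrightarrow> (\<forall>q. q \<notin> {5, 13, 14, 15} \<longrightarrow> t' q = s q) \<and>
      (\<forall>a. t' 5 a = of_bool (a < j \<and> (\<exists>b<n. \<exists>c<n. bad a b c)))" for j and t' :: state
    have "I (s 0 0) (sem mark_nonsimplicial s)" unfolding mark_nonsimplicial_def
    proof (rule sem_For_rule)
      show "I 0 s" unfolding I_def using s5 by simp
    next
      fix j t' assume j: "j < s 0 0" and I: "I j t'"
      let ?t = "upd t' 13 0 j"
      have st: "stores_graph G n k ?t" "?t 13 0 = j" "j < n"
        using s j n I unfolding I_def stores_graph_def by auto
      then have "sem (For 14 (For 15 ?body)) ?t 5 = (t' 5)(j := if \<exists>b<n. \<exists>c<n. bad j b c then 1 else t' 5 j)"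
        using middle[of ?t j] by auto
      moreover have "\<forall>q\<in>- {5, 14, 15}. sem (For 14 (For 15 ?body)) ?t q = ?t q"
        by (rule sem_not_writes_all) auto
      ultimately show "I (Suc j) (sem (For 14 (For 15 ?body)) ?t)"
        using I unfolding I_def by (auto simp: less_Suc_eq)
    qed (simp add: I_def)
    then show ?thesis unfolding I_def n by simp
  qed
  interpret pair_graph G by fact
  show "stores_graph G n k (sem mark_nonsimplicial s)"
    using outer s unfolding stores_graph_def by simp
  have "a \<in> nonsimplicial G \<longleftrightarrow> (\<exists>b<n. \<exists>c<n. bad a b c)" if "a < n" for a
  proof -
    have sub: "closed_nbhd G a \<subseteq> {0..<n}" unfolding closed_nbhd_def using adj_verts V that by auto
    have "a \<in> nonsimplicial G \<longleftrightarrow> \<not> (\<forall>b\<in>closed_nbhd G a. \<forall>c\<in>closed_nbhd G a. b \<noteq> c \<longrightarrow> (b, c) \<in> parcs G)"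
      using that V sub unfolding nonsimplicial_def clique_def by simp
    also have "\<dots> \<longleftrightarrow> (\<exists>b<n. \<exists>c<n. bad a b c)"
    proof
      assume "\<not> (\<forall>b\<in>closed_nbhd G a. \<forall>c\<in>closed_nbhd G a. b \<noteq> c \<longrightarrow> (b, c) \<in> parcs G)"
      then obtain b c where bc: "b \<in> closed_nbhd G a" "c \<in> closed_nbhd G a" "b \<noteq> c" "(b, c) \<notin> parcs G"
        by blast
      then have "c \<notin> closed_nbhd G b" unfolding closed_nbhd_def by auto
      moreover have "b < n" "c < n" using bc sub by auto
      ultimately show "\<exists>b<n. \<exists>c<n. bad a b c" using bc unfolding bad_def by blast
    next
      assume "\<exists>b<n. \<exists>c<n. bad a b c"
      then obtain b c where bc: "b \<in> closed_nbhd G a" "c \<in> closed_nbhd G a" "c \<notin> closed_nbhd G b"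
        unfolding bad_def by blast
      then have "b \<noteq> c" "(b, c) \<notin> parcs G" unfolding closed_nbhd_def by auto
      with bc show "\<not> (\<forall>b\<in>closed_nbhd G a. \<forall>c\<in>closed_nbhd G a. b \<noteq> c \<longrightarrow> (b, c) \<in> parcs G)" by blast
    qed
    finally show ?thesis .
  qed
  then show "stores_flags G n (sem mark_nonsimplicial s)"
    using outer unfolding stores_flags_def by simp
qed

lemma stores_graph_frame: "stores_graph G n k s \<Longrightarrow> \<forall>q\<in>{0, 1, 3, 4}. t q = s q \<Longrightarrow> stores_graph G n k t"
  unfolding stores_graph_def by simp

lemma stores_flags_frame: "stores_flags G n s \<Longrightarrow> t 5 = s 5 \<Longrightarrow> stores_flags G n t"
  unfolding stores_flags_def by simp

context pair_graph
begin

lemma core_subset: "v \<in> pverts G \<Longrightarrow> core G v \<subseteq> pverts G"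
  unfolding core_def nonsimplicial_def closed_nbhd_def using adj_verts by auto

lemma satellites_subset: "satellites G v \<subseteq> pverts G - core G v"
  unfolding satellites_def by blast

lemma core_self: "v \<in> core G v"
  unfolding core_def closed_nbhd_def by simp

end

lemma mark_core_correct:
  assumes s: "stores_graph G n k s" "stores_flags G n s" "s 13 0 = v" "s 10 0 = 0"
    and v: "v < n" and core: "core G v \<subseteq> {0..<n}"
  defines "s' \<equiv> sem mark_core s"
  shows "\<And>c. c < n \<Longrightarrow> s' 6 c = of_bool (c \<in> core G v)"
    and "\<And>c. c < n \<Longrightarrow> s' 8 c = 0" and "\<And>c. c < n \<Longrightarrow> s' 9 c = 0"
    and "s' 10 0 = card (core G v)"
proof -
  define I where "I j t \<longleftrightarrow> (\<forall>q. q \<notin> {14, 8, 9, 6, 10} \<longrightarrow> t q = s q) \<and>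
    (\<forall>c<j. t 6 c = of_bool (c \<in> core G v) \<and> t 8 c = 0 \<and> t 9 c = 0) \<and>
    t 10 0 = card (core G v \<inter> {0..<j})" for j and t :: state
  have n: "s 0 0 = n" using s unfolding stores_graph_def by simp
  have "I (s 0 0) s'" unfolding s'_def mark_core_def
  proof (rule sem_For_rule)
    show "I 0 s" unfolding I_def using s by simp
  next
    fix j and t :: state assume j: "j < s 0 0" and I: "I j t"
    have flags: "s 5 v = of_bool (v \<in> nonsimplicial G)" "s 5 j = of_bool (j \<in> nonsimplicial G)"
      "s 3 (s 4 v + j) = of_bool (j \<in> closed_nbhd G v)"
      using s v j n unfolding stores_flags_def stores_graph_def by auto
    let ?c = "Assign 8 (var 14) (Lit 0) ;; Assign 9 (var 14) (Lit 0) ;;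
      Cond (Cell 5 (var 13)) (Lit 1) (Assign 6 (var 14) (adj 13 14)) (Assign 6 (var 14) (Cell 5 (var 14))) ;;
      Assign 10 (Lit 0) (Plus (var 10) (Cell 6 (var 14)))"
    define t' where "t' = sem ?c (upd t 14 0 j)"
    have t': "\<And>q. q \<notin> {14, 8, 9, 6, 10} \<Longrightarrow> t' q = s q" "t' 8 = (t 8)(j := 0)" "t' 9 = (t 9)(j := 0)"
      "t' 6 = (t 6)(j := of_bool (j \<in> core G v))" "t' 10 0 = t 10 0 + of_bool (j \<in> core G v)"
      using I flags s(3) unfolding t'_def I_def core_def by auto
    have "card (core G v \<inter> {0..<Suc j}) = card (core G v \<inter> {0..<j}) + of_bool (j \<in> core G v)"
      by (simp add: atLeast0_lessThan_Suc)
    then have "I (Suc j) t'" using I t' unfolding I_def by (auto simp: less_Suc_eq)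
    then show "I (Suc j) (sem ?c (upd t 14 0 j))" unfolding t'_def .
  qed (simp add: I_def)
  then show "\<And>c. c < n \<Longrightarrow> s' 6 c = of_bool (c \<in> core G v)"
    "\<And>c. c < n \<Longrightarrow> s' 8 c = 0" "\<And>c. c < n \<Longrightarrow> s' 9 c = 0" "s' 10 0 = card (core G v)"
    using core unfolding I_def n by (auto simp: Int_absorb2)
qed

lemma mark_satellites_correct:
  assumes G: "pair_graph G" and V: "pverts G = {0..<n}"
    and s: "stores_graph G n k s" "stores_flags G n s" and s6: "\<And>c. c < n \<Longrightarrow> s 6 c = of_bool (c \<in> core G v)"
    and s7: "\<And>u. u \<ge> n \<Longrightarrow> s 7 (Suc u) = 0"
  shows "sem mark_satellites s 7 (Suc u) = of_bool (u \<in> satellites G v)"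
proof -
  interpret pair_graph G by fact
  define bad where "bad u w \<longleftrightarrow> w \<in> closed_nbhd G u \<and> w \<in> nonsimplicial G \<and> w \<notin> core G v" for u w
  let ?inner = "For 15 (Cond (Plus (Lit 1) (Cell 6 (var 15))) (Plus (adj 14 15) (Cell 5 (var 15)))
    (Assign 7 (Plus (var 14) (Lit 1)) (Lit 0)) Skip)"
  have n: "s 0 0 = n" using s unfolding stores_graph_def by simp
  have inner: "sem ?inner t 7 = (t 7)(Suc u := if \<exists>w<n. bad u w then 0 else t 7 (Suc u))"
    if t: "\<And>q. q \<notin> {7, 14, 15} \<Longrightarrow> t q = s q" "t 14 0 = u" "u < n" for t u
  proof -
    define I where "I j t' \<longleftrightarrow> (\<forall>q. q \<notin> {7, 15} \<longrightarrow> t' q = t q) \<and>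
      t' 7 = (t 7)(Suc u := if \<exists>w<j. bad u w then 0 else t 7 (Suc u))" for j and t' :: state
    have tn: "t 0 0 = n" using t n by simp
    have "I (t 0 0) (sem ?inner t)"
    proof (rule sem_For_rule)
      show "I 0 t" unfolding I_def by simp
    next
      fix j and t' :: state assume j: "j < t 0 0" and I: "I j t'"
      let ?c = "Cond (Plus (Lit 1) (Cell 6 (var 15))) (Plus (adj 14 15) (Cell 5 (var 15)))
        (Assign 7 (Plus (var 14) (Lit 1)) (Lit 0)) Skip"
      have flags: "s 5 j = of_bool (j \<in> nonsimplicial G)" "s 6 j = of_bool (j \<in> core G v)"
        "s 3 (s 4 u + j) = of_bool (j \<in> closed_nbhd G u)"
        using s s6 t j tn unfolding stores_flags_def stores_graph_def by auto
      have "sem ?c (upd t' 15 0 j) = (if bad u j then upd (upd t' 15 0 j) 7 (Suc u) 0 else upd t' 15 0 j)"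
        using I flags t unfolding I_def bad_def by simp
      then show "I (Suc j) (sem ?c (upd t' 15 0 j))"
        using I unfolding I_def by (auto simp: less_Suc_eq fun_eq_iff)
    qed (simp add: I_def)
    then show ?thesis unfolding I_def tn by blast
  qed
  have sat: "u \<in> satellites G v \<longleftrightarrow> u \<notin> core G v \<and> u \<notin> nonsimplicial G \<and> \<not> (\<exists>w<n. bad u w)" if "u < n" for u
  proof -
    have "closed_nbhd G u \<subseteq> {0..<n}" unfolding closed_nbhd_def using adj_verts V that by auto
    then have "bad u w \<Longrightarrow> w < n" for w unfolding bad_def by auto
    then have "(\<exists>w<n. bad u w) \<longleftrightarrow> (\<exists>w. bad u w)" by blast
    then show ?thesis using that V unfolding satellites_def bad_def closed_nbhd_def by auto
  qed
  define I where "I j t \<longleftrightarrow> (\<forall>q. q \<notin> {7, 14, 15} \<longrightarrow> t q = s q) \<and>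
    (\<forall>u<j. t 7 (Suc u) = of_bool (u \<in> satellites G v)) \<and> (\<forall>u\<ge>n. t 7 (Suc u) = 0)" for j and t :: state
  have "I (s 0 0) (sem mark_satellites s)" unfolding mark_satellites_def
  proof (rule sem_For_rule)
    show "I 0 s" unfolding I_def using s7 by simp
  next
    fix j and t :: state assume j: "j < s 0 0" and I: "I j t"
    let ?t = "upd (upd (upd t 14 0 j) 7 (Suc j) 0) 7 (Suc j) 1"
    let ?d = "Cond (Plus (Cell 6 (var 14)) (Cell 5 (var 14))) (Lit 1)
       (Assign 7 (Plus (var 14) (Lit 1)) (Lit 1) ;; ?inner) Skip"
    let ?c = "Assign 7 (Plus (var 14) (Lit 1)) (Lit 0) ;; ?d"
    have flags: "s 5 j = of_bool (j \<in> nonsimplicial G)" "s 6 j = of_bool (j \<in> core G v)"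
      using s s6 j n unfolding stores_flags_def by auto
    have eq: "sem ?c (upd t 14 0 j) = (if j \<notin> core G v \<and> j \<notin> nonsimplicial G then sem ?inner ?t
        else upd (upd t 14 0 j) 7 (Suc j) 0)"
      using I flags unfolding I_def by simp
    have "sem ?inner ?t q = ?t q" if "q \<notin> {7, 15}" for q
      by (rule sem_not_writes) (use that in auto)
    moreover have "sem ?inner ?t 7 = (?t 7)(Suc j := if \<exists>w<n. bad j w then 0 else ?t 7 (Suc j))"
      using I j n unfolding I_def by (intro inner) auto
    ultimately show "I (Suc j) (sem ?c (upd t 14 0 j))"
      using I j n sat[of j] unfolding eq I_def by (auto simp: less_Suc_eq)
  qed (simp add: I_def)
  then show ?thesis using V satellites_subset[of v] unfolding I_def n by (cases "u < n") auto
qed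

lemma find_cheapest_correct:
  assumes C: "C \<subseteq> {0..<n}"
    and s: "s 0 0 = n" "s 16 0 = u" "s 11 0 = n"
    and E: "\<And>c. c < n \<Longrightarrow> Suc 0 < s 3 (s 4 u + c) + s 6 c \<longleftrightarrow> c \<in> C \<and> E u c"
  defines "s' \<equiv> sem find_cheapest s"
  shows "s' 11 0 \<le> n" and "s' 11 0 < n \<Longrightarrow> s' 12 0 \<in> C \<and> E u (s' 12 0) \<and> s 8 (s' 12 0) = s' 11 0"
    and "\<And>c. c \<in> C \<Longrightarrow> E u c \<Longrightarrow> s' 11 0 \<le> s 8 c"
proof -
  define I where "I j t \<longleftrightarrow> (\<forall>q. q \<notin> {17, 11, 12} \<longrightarrow> t q = s q) \<and> t 11 0 \<le> n \<and>
    (t 11 0 < n \<longrightarrow> t 12 0 \<in> C \<and> E u (t 12 0) \<and> s 8 (t 12 0) = t 11 0) \<and>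
    (\<forall>c<j. c \<in> C \<longrightarrow> E u c \<longrightarrow> t 11 0 \<le> s 8 c)" for j and t :: state
  have "I (s 0 0) s'" unfolding s'_def find_cheapest_def
  proof (rule sem_For_rule)
    show "I 0 s" unfolding I_def using s by simp
  next
    fix j and t :: state assume j: "j < s 0 0" and I: "I j t"
    let ?c = "Cond (Lit 1) (Plus (adj 16 17) (Cell 6 (var 17)))
     (Cond (Cell 8 (var 17)) (var 11)
        (Assign 11 (Lit 0) (Cell 8 (var 17)) ;; Assign 12 (Lit 0) (var 17)) Skip) Skip"
    have "sem ?c (upd t 17 0 j) = (if j \<in> C \<and> E u j \<and> s 8 j < t 11 0
        then upd (upd (upd t 17 0 j) 11 0 (s 8 j)) 12 0 j else upd t 17 0 j)"
      using I s E[of j] j unfolding I_def by simp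
    then show "I (Suc j) (sem ?c (upd t 17 0 j))"
      using I unfolding I_def by (auto simp: less_Suc_eq)
  qed (simp add: I_def)
  then show "s' 11 0 \<le> n" "s' 11 0 < n \<Longrightarrow> s' 12 0 \<in> C \<and> E u (s' 12 0) \<and> s 8 (s' 12 0) = s' 11 0"
    "\<And>c. c \<in> C \<Longrightarrow> E u c \<Longrightarrow> s' 11 0 \<le> s 8 c"
    using C unfolding I_def s(1) by auto
qed

text \<open>The cell \<open>t 10 0\<close> starts at \<open>card C\<close> and is incremented whenever a bidder gives up;
  \<open>p\<close> is the number of bids and withdrawals so far.\<close>

definition auction_state :: "nat set \<Rightarrow> nat set \<Rightarrow> (nat \<Rightarrow> nat \<Rightarrow> bool) \<Rightarrow> nat \<Rightarrow> nat \<Rightarrow> state \<Rightarrow> bool" where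
  "auction_state U C E n p t \<longleftrightarrow> t 0 0 = n \<and>
     (\<forall>u<n. \<forall>c<n. Suc 0 < t 3 (t 4 u + c) + t 6 c \<longleftrightarrow> c \<in> C \<and> E u c) \<and>
     (\<exists>g. t 10 0 = card C + g \<and> p = sum (t 8) C + g \<and> auction U C E n (t 7) (t 8) (t 9) g)"

lemma bid_correct:
  assumes U: "U \<subseteq> {0..<n}" and C: "C \<subseteq> {0..<n}"
    and s: "auction_state U C E n p s" "s 16 0 = u" "u < n" "s 7 (Suc u) \<noteq> 0"
  shows "auction_state U C E n (Suc p) (sem bid s)"
proof -
  obtain g where g: "s 10 0 = card C + g" "p = sum (s 8) C + g" "auction U C E n (s 7) (s 8) (s 9) g"
    using s unfolding auction_state_def by blast
  have sn: "s 0 0 = n" and E: "\<And>u c. u < n \<Longrightarrow> c < n \<Longrightarrow> Suc 0 < s 3 (s 4 u + c) + s 6 c \<longleftrightarrow> c \<in> C \<and> E u c"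
    using s unfolding auction_state_def by auto
  have u: "u \<in> U" using g(3) s(4) unfolding auction_def by auto
  have finC: "finite C" using C finite_subset by blast
  define t where "t = sem find_cheapest (upd s 11 0 n)"
  have frame: "t q = s q" if "q \<notin> {11, 12, 17}" for q
  proof -
    have "t q = upd s 11 0 n q" unfolding t_def by (rule sem_not_writes) (use that in auto)
    then show ?thesis using that by simp
  qed
  have t: "t 11 0 \<le> n" "t 11 0 < n \<Longrightarrow> t 12 0 \<in> C \<and> E u (t 12 0) \<and> s 8 (t 12 0) = t 11 0"
    "\<And>c. c \<in> C \<Longrightarrow> E u c \<Longrightarrow> t 11 0 \<le> s 8 c"
    using find_cheapest_correct[OF C, of "upd s 11 0 n" u E] sn s E[OF s(3)] unfolding t_def by auto
  show ?thesis
  proof (cases "t 11 0 < n")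
    case True
    let ?c = "t 12 0"
    have c: "?c \<in> C" "E u ?c" "s 8 ?c < n" "\<And>d. d \<in> C \<Longrightarrow> E u d \<Longrightarrow> s 8 ?c \<le> s 8 d"
      using t True by auto
    have eq: "sem bid s = upd (upd (upd (upd t 7 (Suc u) 0) 7 (s 9 ?c) 1) 9 ?c (Suc u)) 8 ?c (Suc (s 8 ?c))"
      using s sn True frame unfolding bid_def t_def by simp
    have "sum ((s 8)(?c := Suc (s 8 ?c))) C = Suc (sum (s 8) C)"
      using finC c(1) by (simp add: sum.remove[of C ?c])
    moreover have "auction U C E n ((s 7)(Suc u := 0, s 9 ?c := 1)) ((s 8)(?c := Suc (s 8 ?c))) ((s 9)(?c := Suc u)) g"
      using auction_bid[OF g(3) u s(4) c] .
    ultimately show ?thesis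
      using sn E g(1,2) frame unfolding auction_state_def eq by simp
  next
    case False
    then have c: "\<And>c. c \<in> C \<Longrightarrow> E u c \<Longrightarrow> n \<le> s 8 c" using t by fastforce
    have eq: "sem bid s = upd (upd t 7 (Suc u) 0) 10 0 (Suc (s 10 0))"
      using s sn False frame unfolding bid_def t_def by simp
    have "auction U C E n ((s 7)(Suc u := 0)) (s 8) (s 9) (Suc g)"
      using auction_give_up[OF g(3) _ u s(4) c] U finite_subset by blast
    then show ?thesis
      using sn E g(1,2) frame unfolding auction_state_def eq by (intro conjI exI[of _ "Suc g"]) auto
  qed
qed

text \<open>Each round makes progress unless the auction is over, and there is room for fewer than
  \<open>n\<^sup>2\<close> steps while somebody is still bidding.\<close>

definition after_rounds :: "nat set \<Rightarrow> nat set \<Rightarrow> (nat \<Rightarrow> nat \<Rightarrow> bool) \<Rightarrow> nat \<Rightarrow> nat \<Rightarrow> state \<Rightarrow> bool" where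
  "after_rounds U C E n m t \<longleftrightarrow> (\<exists>p. auction_state U C E n p t \<and> (m \<le> p \<or> (\<forall>u<n. t 7 (Suc u) = 0)))"

lemma auction_state_counter: "auction_state U C E n p t \<Longrightarrow> q \<in> {13..17} \<Longrightarrow> auction_state U C E n p (upd t q x y)"
  unfolding auction_state_def by auto

lemma after_rounds_counter: "after_rounds U C E n m t \<Longrightarrow> q \<in> {13..17} \<Longrightarrow> after_rounds U C E n m (upd t q x y)"
  unfolding after_rounds_def using auction_state_counter by fastforce

lemma round_correct:
  assumes U: "U \<subseteq> {0..<n}" and C: "C \<subseteq> {0..<n}" and s: "after_rounds U C E n m s"
  shows "after_rounds U C E n (Suc m) (sem (For 16 bid) s)"
proof -
  define I where "I j t \<longleftrightarrow> (\<exists>p. auction_state U C E n p t \<and>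
    (Suc m \<le> p \<or> m \<le> p \<and> (\<forall>u<j. t 7 (Suc u) = 0) \<or> (\<forall>u<n. t 7 (Suc u) = 0)))" for j t
  have n: "s 0 0 = n" using s unfolding after_rounds_def auction_state_def by blast
  have "I (s 0 0) (sem (For 16 bid) s)"
  proof (rule sem_For_rule)
    show "I 0 s" using s unfolding I_def after_rounds_def by auto
  next
    fix j t assume j: "j < s 0 0" and I: "I j t"
    obtain p where p: "auction_state U C E n p t"
      "Suc m \<le> p \<or> m \<le> p \<and> (\<forall>u<j. t 7 (Suc u) = 0) \<or> (\<forall>u<n. t 7 (Suc u) = 0)"
      using I unfolding I_def by blast
    let ?t = "upd t 16 0 j"
    have t: "auction_state U C E n p ?t" "?t 16 0 = j" "?t 7 = t 7" "j < n"
      using auction_state_counter[OF p(1)] j n by auto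
    show "I (Suc j) (sem bid ?t)"
    proof (cases "t 7 (Suc j) = 0")
      case True
      then have "sem bid ?t = ?t" unfolding bid_def by simp
      then show ?thesis using p True t unfolding I_def by (auto simp: less_Suc_eq)
    next
      case False
      then have "?t 7 (Suc j) \<noteq> 0" unfolding t(3) .
      then have "auction_state U C E n (Suc p) (sem bid ?t)" by (rule bid_correct[OF U C t(1,2,4)])
      moreover have "Suc m \<le> Suc p" using p(2) False t(4) by auto
      ultimately show ?thesis unfolding I_def by blast
    qed
  next
    fix t assume "I (s 0 0) t"
    then show "I (s 0 0) (upd t 16 0 (s 0 0))"
      unfolding I_def using auction_state_counter[of U C E n _ t 16] by fastforce
  qed
  then show ?thesis unfolding I_def after_rounds_def n by blast
qed

lemma run_auction_correct:
  assumes U: "U \<subseteq> {0..<n}" and C: "C \<subseteq> {0..<n}" and UC: "U \<inter> C = {}" "C \<noteq> {}"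
    and s: "auction_state U C E n p s"
  shows "\<exists>p. auction_state U C E n p (sem run_auction s) \<and> (\<forall>u<n. sem run_auction s 7 (Suc u) = 0)"
proof -
  have n: "t 0 0 = n" if "after_rounds U C E n m t" for m t
    using that unfolding after_rounds_def auction_state_def by blast
  have s0: "after_rounds U C E n 0 s" using s unfolding after_rounds_def by auto
  have row: "after_rounds U C E n (m + n) (sem (For 15 (For 16 bid)) t)" if t: "after_rounds U C E n m t" for m t
  proof -
    define I where "I j t = after_rounds U C E n (m + j) t" for j t
    have "I (t 0 0) (sem (For 15 (For 16 bid)) t)"
    proof (rule sem_For_rule)
      show "I 0 t" using t unfolding I_def by simp
    next
      fix j t assume "I j t"
      then have "after_rounds U C E n (m + j) (upd t 15 0 j)"
        unfolding I_def by (intro after_rounds_counter) auto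
      then show "I (Suc j) (sem (For 16 bid) (upd t 15 0 j))"
        unfolding I_def using round_correct[OF U C] by fastforce
    next
      fix t' assume "I (t 0 0) t'"
      then show "I (t 0 0) (upd t' 15 0 (t 0 0))" unfolding I_def by (intro after_rounds_counter) auto
    qed
    then show ?thesis unfolding I_def n[OF t] .
  qed
  define I where "I j t = after_rounds U C E n (j * n) t" for j t
  have "I (s 0 0) (sem run_auction s)" unfolding run_auction_def
  proof (rule sem_For_rule)
    show "I 0 s" using s0 unfolding I_def by simp
  next
    fix j t assume "I j t"
    then have "after_rounds U C E n (j * n) (upd t 14 0 j)"
      unfolding I_def by (intro after_rounds_counter) auto
    then show "I (Suc j) (sem (For 15 (For 16 bid)) (upd t 14 0 j))"
      unfolding I_def using row by (fastforce simp: add.commute)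
  next
    fix t assume "I (s 0 0) t"
    then show "I (s 0 0) (upd t 14 0 (s 0 0))" unfolding I_def by (intro after_rounds_counter) auto
  qed
  then obtain p where p: "auction_state U C E n p (sem run_auction s)"
    "n * n \<le> p \<or> (\<forall>u<n. sem run_auction s 7 (Suc u) = 0)"
    unfolding I_def n[OF s0] after_rounds_def by blast
  have fin: "finite U" "finite C" using U C finite_subset by blast+
  have "sem run_auction s 7 (Suc u) = 0" if u: "u < n" for u
  proof (rule ccontr)
    assume nz: "sem run_auction s 7 (Suc u) \<noteq> 0"
    let ?t = "sem run_auction s"
    obtain g where g: "p = sum (?t 8) C + g" "auction U C E n (?t 7) (?t 8) (?t 9) g"
      using p unfolding auction_state_def by blast
    have uU: "u \<in> U" using g(2) nz unfolding auction_def by auto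
    have "p < card C * n + card U" using auction_progress_bound[OF g(2) fin(1) uU nz] g(1) by simp
    moreover have "card U + card C \<le> n"
      using card_mono[of "{0..<n}" "U \<union> C"] card_Un_disjoint[OF fin UC(1)] U C by simp
    moreover have "0 < card U" using fin uU by (auto simp: card_gt_0_iff)
    moreover have "card C * n + card U \<le> n * n"
    proof -
      have "card U \<le> card U * n" using u by simp
      then have "card C * n + card U \<le> (card U + card C) * n" by (simp add: algebra_simps)
      also have "\<dots> \<le> n * n" using \<open>card U + card C \<le> n\<close> by (rule mult_le_mono1)
      finally show ?thesis .
    qed
    ultimately show False using p(2) u nz by auto
  qed
  with p(1) show ?thesis by blast
qed

definition rank_witness :: "nat pair_pre_digraph \<Rightarrow> nat \<Rightarrow> nat \<Rightarrow> bool" where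
  "rank_witness G k v \<longleftrightarrow> (\<exists>X\<subseteq>satellites G v. k \<le> card X + card (core G v - parcs G `` X))"

lemma iteration_correct:
  assumes G: "pair_graph G" and V: "pverts G = {0..<n}"
    and s: "stores_graph G n k s" "stores_flags G n s" "s 13 0 = v" and v: "v < n"
    and s7: "\<And>u. u \<ge> n \<Longrightarrow> s 7 (Suc u) = 0"
  defines "s' \<equiv> sem (Assign 10 (Lit 0) (Lit 0) ;; mark_core ;; mark_satellites ;; run_auction ;;
      Cond (var 10) (var 1) Skip (Assign 2 (Lit 0) (Lit 1))) s"
  shows "stores_graph G n k s'" "stores_flags G n s'" "\<And>u. u \<ge> n \<Longrightarrow> s' 7 (Suc u) = 0"
    and "0 < s' 2 0 \<longleftrightarrow> 0 < s 2 0 \<or> rank_witness G k v"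
proof -
  interpret pair_graph G by fact
  let ?C = "core G v" and ?U = "satellites G v" and ?E = "\<lambda>u c. c \<in> closed_nbhd G u"
  define s1 where "s1 = upd s 10 0 0"
  define s2 where "s2 = sem mark_core s1"
  define s3 where "s3 = sem mark_satellites s2"
  define s4 where "s4 = sem run_auction s3"
  have s': "s' = (if s4 10 0 < s4 1 0 then s4 else upd s4 2 0 1)"
    unfolding s'_def s4_def s3_def s2_def s1_def by simp
  have f1: "\<forall>q\<in>- {10}. s1 q = s q" unfolding s1_def by simp
  have f2: "\<forall>q\<in>- {14, 8, 9, 6, 10}. s2 q = s1 q"
    unfolding s2_def by (rule sem_not_writes_all) auto
  have f3: "\<forall>q\<in>- {14, 7, 15}. s3 q = s2 q"
    unfolding s3_def by (rule sem_not_writes_all) auto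
  have f4: "\<forall>q\<in>- {14, 15, 16, 11, 17, 12, 7, 9, 8, 10}. s4 q = s3 q"
    unfolding s4_def by (rule sem_not_writes_all) auto
  have sub: "?C \<subseteq> {0..<n}" "?U \<subseteq> {0..<n}" "?U \<inter> ?C = {}" "?C \<noteq> {}"
    using core_subset satellites_subset[of v] core_self[of v] V v by auto
  have fin: "finite ?U" "finite ?C" using sub finite_subset by blast+
  have g1: "stores_graph G n k s1" "stores_flags G n s1"
    using stores_graph_frame[OF s(1)] stores_flags_frame[OF s(2)] f1 by auto
  have g2: "stores_graph G n k s2" "stores_flags G n s2"
    using stores_graph_frame[OF g1(1)] stores_flags_frame[OF g1(2)] f2 by auto
  have g3: "stores_graph G n k s3" "stores_flags G n s3"
    using stores_graph_frame[OF g2(1)] stores_flags_frame[OF g2(2)] f3 by auto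
  have g4: "stores_graph G n k s4" "stores_flags G n s4"
    using stores_graph_frame[OF g3(1)] stores_flags_frame[OF g3(2)] f4 by auto
  have s1: "s1 13 0 = v" "s1 10 0 = 0" using s(3) unfolding s1_def by auto
  have s2: "\<And>c. c < n \<Longrightarrow> s2 6 c = of_bool (c \<in> ?C)" "\<And>c. c < n \<Longrightarrow> s2 8 c = 0"
    "\<And>c. c < n \<Longrightarrow> s2 9 c = 0" "s2 10 0 = card ?C"
    using mark_core_correct[OF g1 s1 v sub(1)] unfolding s2_def by auto
  have s2_7: "s2 7 (Suc u) = 0" if "u \<ge> n" for u using s7[OF that] f1 f2 by simp
  have s3_7: "s3 7 (Suc u) = of_bool (u \<in> ?U)" for u
    unfolding s3_def using mark_satellites_correct[OF G V g2 s2(1) s2_7] by blast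
  have s3: "\<And>c. c < n \<Longrightarrow> s3 6 c = of_bool (c \<in> ?C)" "\<And>c. c < n \<Longrightarrow> s3 8 c = 0"
    "\<And>c. c < n \<Longrightarrow> s3 9 c = 0" "s3 10 0 = card ?C"
    using s2 f3 by auto
  have "auction ?U ?C ?E n (s3 7) (s3 8) (s3 9) 0"
    using s3 s3_7 sub(1) by (intro auction_init) auto
  moreover have "sum (s3 8) ?C = 0" using s3(2) sub(1) by (intro sum.neutral) auto
  ultimately have "auction_state ?U ?C ?E n 0 s3"
    using g3 s3 unfolding auction_state_def stores_graph_def by auto
  from run_auction_correct[OF sub(2,1,3,4) this] obtain p where
    p: "auction_state ?U ?C ?E n p s4" and idle: "\<forall>u<n. s4 7 (Suc u) = 0"
    unfolding s4_def by blast
  obtain g where g: "s4 10 0 = card ?C + g" "auction ?U ?C ?E n (s4 7) (s4 8) (s4 9) g"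
    using p unfolding auction_state_def by blast
  have small: "card ?C < n" if "?U \<noteq> {}"
  proof -
    have "card ?C < card {0..<n}" using sub that by (intro psubset_card_mono) auto
    then show ?thesis by simp
  qed
  have "s4 7 (Suc u) = 0" if "u \<in> ?U" for u using idle sub(2) that by auto
  from auction_result[OF g(2) fin this small]
  have "k \<le> card ?C + g \<longleftrightarrow> (\<exists>X\<subseteq>?U. k \<le> card X + card (?C - {c. \<exists>u\<in>X. ?E u c}))" .
  also have "\<dots> \<longleftrightarrow> rank_witness G k v"
  proof -
    have "?C - {c. \<exists>u\<in>X. ?E u c} = ?C - parcs G `` X" if "X \<subseteq> ?U" for X
      using that sub(3) unfolding closed_nbhd_def by auto
    then show ?thesis unfolding rank_witness_def by (metis (no_types, lifting))
  qed
  finally have res: "s4 10 0 < s4 1 0 \<longleftrightarrow> \<not> rank_witness G k v"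
    using g(1) g4(1) unfolding stores_graph_def by auto
  have "s4 2 = s 2" using f1 f2 f3 f4 by simp
  then show "0 < s' 2 0 \<longleftrightarrow> 0 < s 2 0 \<or> rank_witness G k v" unfolding s' using res by simp
  show "stores_graph G n k s'" "stores_flags G n s'"
    using stores_graph_frame[OF g4(1), of s'] stores_flags_frame[OF g4(2), of s'] unfolding s' by auto
  fix u assume "u \<ge> n"
  then have "s4 7 (Suc u) = 0" using g(2) sub(2) unfolding auction_def by auto
  then show "s' 7 (Suc u) = 0" unfolding s' by simp
qed

lemma rank_program_correct:
  assumes G: "pair_graph G" and V: "pverts G = {0..<n}"
    and s: "s 0 0 = n" "s 1 0 = k" "\<And>r. r \<notin> {0, 1, 30} \<Longrightarrow> s r = (\<lambda>_. 0)"
    and matrix: "\<And>u w. u < n \<Longrightarrow> w < n \<Longrightarrow> s 30 (u * n + w) = of_bool ((u, w) \<in> parcs G)"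
  shows "0 < sem rank_program s 2 0 \<longleftrightarrow> (\<exists>v<n. rank_witness G k v)"
proof -
  define s1 where "s1 = sem read_graph s"
  define s2 where "s2 = sem mark_nonsimplicial s1"
  let ?body = "Assign 10 (Lit 0) (Lit 0) ;; mark_core ;; mark_satellites ;; run_auction ;;
      Cond (var 10) (var 1) Skip (Assign 2 (Lit 0) (Lit 1))"
  have "s 30 (u * n + w) = of_bool (w \<in> closed_nbhd G u)" if "u < n" "w < n" "u \<noteq> w" for u w
    using matrix that unfolding closed_nbhd_def by auto
  then have g1: "stores_graph G n k s1"
    unfolding s1_def using s by (intro read_graph_correct) auto
  have f1: "\<forall>q\<in>{2, 5, 7}. s1 q = s q"
    unfolding s1_def by (rule sem_not_writes_all) (auto simp: read_graph_def)
  have f2: "\<forall>q\<in>{2, 7}. s2 q = s1 q"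
    unfolding s2_def by (rule sem_not_writes_all) (auto simp: mark_nonsimplicial_def)
  have "s1 5 u = 0" for u using f1 s(3)[of 5] by simp
  then have g2: "stores_graph G n k s2" "stores_flags G n s2"
    unfolding s2_def using mark_nonsimplicial_correct[OF G V g1] by blast+
  have init: "s2 2 0 = 0" "\<And>u. s2 7 (Suc u) = 0"
    using f1 f2 s(3)[of 2] s(3)[of 7] by auto
  define I where "I j t \<longleftrightarrow> stores_graph G n k t \<and> stores_flags G n t \<and> (\<forall>u\<ge>n. t 7 (Suc u) = 0) \<and>
    (0 < t 2 0 \<longleftrightarrow> (\<exists>v<j. rank_witness G k v))" for j and t :: state
  have n: "s2 0 0 = n" using g2 unfolding stores_graph_def by simp
  have counter: "I j (upd t 13 0 x)" if "I j t" for j t x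
    using that unfolding I_def stores_graph_def stores_flags_def by simp
  have "I (s2 0 0) (sem (For 13 ?body) s2)"
  proof (rule sem_For_rule)
    show "I 0 s2" unfolding I_def using g2 init by simp
  next
    fix j and t :: state assume j: "j < s2 0 0" and I: "I j t"
    let ?t = "upd t 13 0 j"
    have t: "stores_graph G n k ?t" "stores_flags G n ?t" "\<And>u. u \<ge> n \<Longrightarrow> ?t 7 (Suc u) = 0"
      "0 < ?t 2 0 \<longleftrightarrow> (\<exists>v<j. rank_witness G k v)"
      using counter[OF I, of j] unfolding I_def by blast+
    have t13: "?t 13 0 = j" and jn: "j < n" using j n by simp_all
    define t' where "t' = sem ?body ?t"
    have "stores_graph G n k t'" "stores_flags G n t'" "\<And>u. u \<ge> n \<Longrightarrow> t' 7 (Suc u) = 0"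
      "0 < t' 2 0 \<longleftrightarrow> 0 < ?t 2 0 \<or> rank_witness G k j"
      unfolding t'_def using iteration_correct[OF G V t(1,2) t13 jn t(3)] by blast+
    then have "I (Suc j) t'" using t(4) unfolding I_def by (auto simp: less_Suc_eq)
    then show "I (Suc j) (sem ?body ?t)" unfolding t'_def .
  qed (rule counter)
  moreover have "sem rank_program s = sem (For 13 ?body) s2"
    unfolding rank_program_def s2_def s1_def by simp
  ultimately show ?thesis unfolding I_def n by simp
qed

lemma length_matrix: "length (concat (map (\<lambda>u. map (f u) [0..<n]) [0..<m])) = m * n"
  by (induction m) auto

lemma nth_matrix:
  assumes "u < m" "w < n"
  shows "concat (map (\<lambda>u. map (f u) [0..<n]) [0..<m]) ! (u * n + w) = f u w"
  using assms(1)
proof (induction m)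
  case (Suc m)
  show ?case
  proof (cases "u = m")
    case True
    then show ?thesis using assms(2) by (simp add: nth_append length_matrix)
  next
    case False
    then have u: "u < m" using Suc.prems by simp
    then have "u * n + w < Suc u * n" using assms(2) by simp
    also have "\<dots> \<le> m * n" using u by (intro mult_le_mono1) simp
    finally show ?thesis using Suc.IH[OF u] by (simp add: nth_append length_matrix)
  qed
qed simp

lemma length_le_input_size: "length xs \<le> input_size xs"
  unfolding input_size_def by (induction xs) auto

definition matrix :: "nat pair_pre_digraph \<Rightarrow> nat list" where
  "matrix G = (let n = card (pverts G) in
     concat (map (\<lambda>u. map (\<lambda>v. of_bool ((u, v) \<in> parcs G)) [0..<n]) [0..<n]))"

lemma encode_eq: "encode (G, k) = int (card (pverts G)) # k # map int (matrix G)"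
  unfolding encode_def matrix_def Let_def by (simp add: map_concat comp_def of_bool_def if_distrib[of int] cong: if_cong)

theorem corollary2p1:
  shows "polytime_decidable encode
    {(G, k). input_graph G \<and> starlike G}
    (\<lambda>(G, k). int (monophonic_rank G) \<ge> k)"
proof (rule polytime_decidableI[OF wf_rank_program,
      where sz = "\<lambda>(G, k). card (pverts G)" and arg = snd and tape = "\<lambda>(G, k). matrix G"])
  fix x :: "nat pair_pre_digraph \<times> int" assume "x \<in> {(G, k). input_graph G \<and> starlike G}"
  then obtain G k n where x: "x = (G, k)" and G: "pair_graph G" "starlike G" and V: "pverts G = {0..<n}"
    unfolding input_graph_def by blast
  have n: "card (pverts G) = n" using V by simp
  show "encode x = int (case x of (G, k) \<Rightarrow> card (pverts G)) # snd x # map int (case x of (G, k) \<Rightarrow> matrix G)"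
    unfolding x by (simp add: encode_eq)
  have len: "length (matrix G) = n * n" unfolding matrix_def Let_def n by (rule length_matrix)
  have "n \<le> n * n" by simp
  also have "\<dots> \<le> length (encode x)" unfolding x encode_eq using len by simp
  also have "\<dots> \<le> input_size (encode x)" by (rule length_le_input_size)
  finally show "(case x of (G, k) \<Rightarrow> card (pverts G)) \<le> input_size (encode x)" unfolding x using n by simp
  let ?s = "initial n (nat k) (matrix G)"
  have "?s 30 (u * n + w) = of_bool ((u, w) \<in> parcs G)" if "u < n" "w < n" for u w
  proof -
    have "u * n + w < Suc u * n" using that by simp
    also have "\<dots> \<le> n * n" using that by (intro mult_le_mono1) simp
    finally show ?thesis using len nth_matrix[OF that, of "\<lambda>u v. of_bool ((u, v) \<in> parcs G)"]
      unfolding initial_def matrix_def Let_def n by simp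
  qed
  then have "0 < sem rank_program ?s 2 0 \<longleftrightarrow> (\<exists>v<n. rank_witness G (nat k) v)"
    by (intro rank_program_correct[OF G(1) V]) (auto simp: initial_def)
  also have "\<dots> \<longleftrightarrow> nat k \<le> monophonic_rank G"
    unfolding monophonic_rank_ge_iff[OF G] rank_witness_def V by (simp add: Bex_def)
  finally show "(case x of (G, k) \<Rightarrow> k \<le> int (monophonic_rank G)) \<longleftrightarrow>
    0 < sem rank_program (initial (case x of (G, k) \<Rightarrow> card (pverts G)) (nat (snd x)) (case x of (G, k) \<Rightarrow> matrix G)) 2 0"
    unfolding x using n by (simp add: nat_le_iff)
qed

end
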